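(* There is an algorithm that, given a $\Pi_m\Sigma_3\Pi_t$ polynomial, decides in $O(tm^2\,1.7751^m)$ time whether it has a multilinear monomial in its sum-product expansion.
   Context: Polynomials are in variables $x_1,\dots,x_n$. A monomial is multilinear if every variable occurring in it has exponent $1$. A $\Pi_m\Sigma_3\Pi_t$ polynomial is given as a product of $m$ clauses, each a sum of at most $3$ terms, each term a product of variables of degree at most $t$. The monomials of its sum-product expansion are the products obtained by choosing one term from each clause; it has a multilinear monomial in its sum-product expansion if some such product is multilinear. *)

theory Defs
  imports Complex_Main "HOL-Library.Multiset"
begin

section \<open>Products of sums of products of variables\<close>

text \<open>
  The variable x_i is represented by its index i. The terms of a clause are unexpanded products
  of variables, with repetitions allowed; the degree of a term is the length of the list.
\<close>

type_synonym prod_term = "nat list"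
type_synonym clause = "prod_term list"
type_synonym psp = "clause list"

definition is_PSP :: "nat \<Rightarrow> nat \<Rightarrow> nat \<Rightarrow> nat \<Rightarrow> psp \<Rightarrow> bool" where
  "is_PSP n m s t F \<longleftrightarrow>
     length F = m \<and>
     (\<forall>C\<in>set F. length C \<le> s \<and> (\<forall>T\<in>set C. length T \<le> t \<and> set T \<subseteq> {1..n}))"

text \<open>A monomial is the multiset of its variables: the exponent of x in M is \<open>count M x\<close>.\<close>

definition multilinear :: "nat multiset \<Rightarrow> bool" where
  "multilinear M \<longleftrightarrow> (\<forall>x\<in>#M. count M x = 1)"

text \<open>Nothing is collected or cancelled here: one monomial for each choice of a term per clause.\<close>

definition expansion_monomials :: "psp \<Rightarrow> nat multiset set" where
  "expansion_monomials F =
     {\<Sum>T\<leftarrow>Ts. mset T | Ts. list_all2 (\<lambda>T C. T \<in> set C) Ts F}"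

definition has_multilinear_monomial :: "psp \<Rightarrow> bool" where
  "has_multilinear_monomial F \<longleftrightarrow> (\<exists>M\<in>expansion_monomials F. multilinear M)"

section \<open>Random access machines\<close>

text \<open>
  A random access machine with the uniform cost measure, programmed with structured control
  flow. It has registers, addressed only by constants in the program, and a memory, addressed
  indirectly through registers; all cells hold natural numbers. The arithmetic is that of
  Cook and Reckhow: addition and (truncated) subtraction. There is deliberately no
  multiplication, shift or bitwise operation, so that charging one unit per instruction
  is polynomially related to Turing machine time.
\<close>

datatype com =
    Const nat nat
  | Add nat nat nat
  | Sub nat nat nat
  | Load nat nat
  | Store nat nat
  | Seq com com
  | IfPos nat com com
  | WhilePos nat com

type_synonym state = "(nat \<Rightarrow> nat) \<times> (nat \<Rightarrow> nat)"

text \<open>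
  \<open>exec p s k s'\<close>: started in state s, the program p halts in state s' after exactly k steps.
  Every instruction and every evaluation of a test counts as one step.
\<close>

inductive exec :: "com \<Rightarrow> state \<Rightarrow> nat \<Rightarrow> state \<Rightarrow> bool" where
  Const: "exec (Const i c) (r, h) 1 (r(i := c), h)"
| Add: "exec (Add i j k) (r, h) 1 (r(i := r j + r k), h)"
| Sub: "exec (Sub i j k) (r, h) 1 (r(i := r j - r k), h)"
| Load: "exec (Load i j) (r, h) 1 (r(i := h (r j)), h)"
| Store: "exec (Store i j) (r, h) 1 (r, h(r i := r j))"
| Seq: "exec p s k s' \<Longrightarrow> exec q s' l s'' \<Longrightarrow> exec (Seq p q) s (k + l) s''"
| IfTrue: "r i > 0 \<Longrightarrow> exec p (r, h) k s' \<Longrightarrow> exec (IfPos i p q) (r, h) (Suc k) s'"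
| IfFalse: "r i = 0 \<Longrightarrow> exec q (r, h) k s' \<Longrightarrow> exec (IfPos i p q) (r, h) (Suc k) s'"
| WhileFalse: "r i = 0 \<Longrightarrow> exec (WhilePos i p) (r, h) 1 (r, h)"
| WhileTrue: "r i > 0 \<Longrightarrow> exec p (r, h) k s' \<Longrightarrow> exec (WhilePos i p) s' l s'' \<Longrightarrow>
    exec (WhilePos i p) (r, h) (Suc (k + l)) s''"

inductive_cases exec_elims:
  "exec (Const i c) s k s'" "exec (Add i j l) s k s'" "exec (Sub i j l) s k s'"
  "exec (Load i j) s k s'" "exec (Store i j) s k s'" "exec (Seq p q) s k s'"
  "exec (IfPos i p q) s k s'" "exec (WhilePos i p) s k s'"

lemma exec_deterministic:
  "exec p s k s' \<Longrightarrow> exec p s l s'' \<Longrightarrow> k = l \<and> s' = s''"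
proof (induction arbitrary: l s'' rule: exec.induct)
  case (Seq p s k s' q l s'' l')
  from Seq.prems obtain k1 l1 s1 where "exec p s k1 s1" "exec q s1 l1 s''" and "l' = k1 + l1"
    by (rule exec_elims) blast
  with Seq.IH show ?case by metis
next
  case (IfTrue r i p h k s' q)
  from IfTrue.prems obtain k1 where "exec p (r, h) k1 s''" "l = Suc k1"
    by (rule exec_elims) (use IfTrue.hyps in auto)
  with IfTrue.IH show ?case by metis
next
  case (IfFalse r i q h k s' p)
  from IfFalse.prems obtain k1 where "exec q (r, h) k1 s''" "l = Suc k1"
    by (rule exec_elims) (use IfFalse.hyps in auto)
  with IfFalse.IH show ?case by metis
next
  case (WhileTrue r i p h k s' l s'' l')
  from WhileTrue.prems obtain k1 l1 s1
    where "exec p (r, h) k1 s1" "exec (WhilePos i p) s1 l1 s''" "l' = Suc (k1 + l1)"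
    by (rule exec_elims) (use WhileTrue.hyps in auto)
  with WhileTrue.IH show ?case by metis
next
  case (WhileFalse r i p h)
  from WhileFalse.prems show ?case
    by (rule exec_elims) (use WhileFalse.hyps in auto)
qed (erule exec_elims, simp)+

text \<open>The input is written to the memory from address 0 on; everything else is initially 0.\<close>

definition init_state :: "nat list \<Rightarrow> state" where
  "init_state xs = ((\<lambda>_. 0), (\<lambda>a. if a < length xs then xs ! a else 0))"

text \<open>The machine answers in register 0: 1 for acceptance, 0 for rejection.\<close>

definition answers :: "com \<Rightarrow> nat list \<Rightarrow> nat \<Rightarrow> bool \<Rightarrow> bool" where
  "answers p xs k b \<longleftrightarrow> (\<exists>r h. exec p (init_state xs) k (r, h) \<and> r 0 = of_bool b)"

section \<open>Inputs\<close>

definition encode_term :: "prod_term \<Rightarrow> nat list" where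
  "encode_term T = length T # T"

definition encode_clause :: "clause \<Rightarrow> nat list" where
  "encode_clause C = length C # concat (map encode_term C)"

text \<open>
  One memory cell per occurrence of a variable, with the number n of variables, the number of
  clauses and the lengths of all lists in front of the data they describe.
\<close>

definition encode_psp :: "nat \<Rightarrow> psp \<Rightarrow> nat list" where
  "encode_psp n F = n # length F # concat (map encode_clause F)"

end

theory Submission imports Defs begin

text \<open>
  Choosing one term per clause so that no variable repeats is a binary constraint satisfaction
  problem: terms with a repeated variable are unusable, and two terms of different clauses conflict
  when they share a variable. The clauses are grouped into pairs. The two positions (out of three)
  chosen in a pair always miss a common third position g, so guessing g for each of the
  (m + 1) div 2 pairs covers all choices and leaves two candidate terms per clause. With only two
  candidates the clauses can be eliminated one after the other, as in Davis and Putnam's procedure: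
  u and v become conflicting if u rules out one candidate of the eliminated clause and v the other.
  This takes O(m^3) steps per guess, and m^3 * sqrt 3 ^ m is O(m^2 * 1.7751^m). The conflict
  matrix itself is computed beforehand in O(t * m^2) steps by marking the variables of each term.
\<close>

section \<open>Elimination of clauses with two candidates\<close>

text \<open>Guessing a discarded position for each clause separately would cost 3^m guesses. Sharing
  it within a pair costs a factor 3 per two clauses, that is sqrt 3 < 1.7321 per clause. The gap to
  1.7751 leaves a factor above 1.02 per clause, whose powers absorb the third factor m. Two
  candidates are the limit for elimination to stay within binary constraints: one vertex blocks the
  first, another the second, and a pair records the failure of both; three candidates would call for
  triples. The guessing works on matrices whose size depends on m only, so t enters just the cost of
  computing the first of them. The step count must not grow with n, so the marks rely on memory
  being 0 initially instead of clearing a cell per variable. As the machine cannot multiply or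
  divide, addresses are carried along by additions; truth values are positivity of cells,
  \<open>Add\<close> is disjunction, and truncated subtraction is comparison.\<close>

definition indep :: "('a \<Rightarrow> 'a \<Rightarrow> bool) \<Rightarrow> 'a set \<Rightarrow> bool" where
  "indep A S \<longleftrightarrow> (\<forall>u\<in>S. \<forall>v\<in>S. \<not> A u v)"

text \<open>A loop \<open>A c c\<close> says that c is forbidden by itself, so every u then counts
  as ruling it out.\<close>

definition blocks :: "('a \<Rightarrow> 'a \<Rightarrow> bool) \<Rightarrow> 'a \<Rightarrow> 'a \<Rightarrow> bool" where
  "blocks A u c \<longleftrightarrow> A u c \<or> A c c"

text \<open>This is resolution on the eliminated clause. The case u = v produces new loops: a vertex
  that blocks both candidates becomes forbidden.\<close>

definition elim :: "('a \<Rightarrow> 'a \<Rightarrow> bool) \<Rightarrow> 'a \<Rightarrow> 'a \<Rightarrow> 'a \<Rightarrow> 'a \<Rightarrow> bool" where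
  "elim A c d u v \<longleftrightarrow>
     A u v \<or> blocks A u c \<and> blocks A v d \<or> blocks A u d \<and> blocks A v c"

lemma symp_elim: "symp A \<Longrightarrow> symp (elim A c d)"
  by (auto simp: elim_def symp_def)

text \<open>If neither candidate extends S, some u in S blocks c and some v in S blocks d, and
  exactly this pair is in conflict afterwards. When c fails only because of its own loop, any member
  of S serves as u, whence \<open>S \<noteq> {}\<close>.\<close>

lemma indep_elim:
  assumes "symp A" "S \<noteq> {}"
  shows "indep (elim A c d) S \<longleftrightarrow> indep A (insert c S) \<or> indep A (insert d S)"
proof
  assume S: "indep (elim A c d) S"
  then have "indep A S" by (auto simp: indep_def elim_def)
  have *: "\<exists>u\<in>S. blocks A u x" if "\<not> indep A (insert x S)" for x
  proof -
    from that obtain u v where uv: "u = x \<or> u \<in> S" "v = x \<or> v \<in> S" "A u v"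
      by (auto simp: indep_def)
    have "A v u" using uv(3) assms(1) by (simp add: sympD)
    moreover obtain w where "w \<in> S" using assms(2) by blast
    moreover have "\<not> (u \<in> S \<and> v \<in> S)" using \<open>indep A S\<close> uv(3) by (auto simp: indep_def)
    ultimately show ?thesis using uv unfolding blocks_def by metis
  qed
  show "indep A (insert c S) \<or> indep A (insert d S)"
  proof (rule ccontr)
    assume "\<not> ?thesis"
    then obtain u v where "u \<in> S" "blocks A u c" "v \<in> S" "blocks A v d"
      using * by meson
    then have "elim A c d u v" by (simp add: elim_def)
    with S \<open>u \<in> S\<close> \<open>v \<in> S\<close> show False by (simp add: indep_def)
  qed
next
  have *: "\<not> blocks A u x" if "indep A (insert x S)" "u \<in> S" for u x
    using that by (simp add: indep_def blocks_def)
  assume "indep A (insert c S) \<or> indep A (insert d S)"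
  moreover from this have "\<not> A u v" if "u \<in> S" "v \<in> S" for u v
    using that unfolding indep_def by blast
  ultimately show "indep (elim A c d) S"
    using * unfolding indep_def[of "elim A c d"] elim_def by metis
qed

definition lower :: "nat \<Rightarrow> nat" where "lower g = (if g = 0 then 1 else 0)"
definition upper :: "nat \<Rightarrow> nat" where "upper g = (if g = 2 then 1 else 2)"

lemma lower_upper:
  assumes "g < 3"
  shows "a = lower g \<or> a = upper g \<longleftrightarrow> a < 3 \<and> a \<noteq> g"
  using assms by (auto simp: lower_def upper_def)

text \<open>
  Candidate number 3 * i + a is the term at position a of clause i, and g i is the position that
  has been ruled out in clause i.
\<close>

primrec elims :: "(nat \<Rightarrow> nat) \<Rightarrow> (nat \<Rightarrow> nat \<Rightarrow> bool) \<Rightarrow> nat \<Rightarrow> nat \<Rightarrow> nat \<Rightarrow> bool" where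
  "elims g A 0 = A"
| "elims g A (Suc k) = elim (elims g A k) (3 * k + lower (g k)) (3 * k + upper (g k))"

lemma symp_elims: "symp A \<Longrightarrow> symp (elims g A k)"
  by (induction k) (auto intro: symp_elim)

lemma elims_complete:
  assumes "symp A" "\<forall>i<m. g i < 3"
  shows "\<not> elims g A m z z \<longleftrightarrow>
    (\<exists>a. (\<forall>i<m. a i < 3 \<and> a i \<noteq> g i) \<and> indep A (insert z ((\<lambda>i. 3 * i + a i) ` {..<m})))"
proof -
  let ?V = "\<lambda>a. \<forall>i<m. a i < 3 \<and> a i \<noteq> g i"
  let ?S = "\<lambda>k a. insert z ((\<lambda>i. 3 * i + a i) ` {k..<m})"
  \<comment> \<open>Each elimination drops the choice for one clause from the set. After all m of
    them only z is left, and independence of that singleton means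
    \<open>\<not> elims g A m z z\<close>.\<close>
  have "(\<exists>a. ?V a \<and> indep A (?S 0 a)) \<longleftrightarrow> (\<exists>a. ?V a \<and> indep (elims g A k) (?S k a))" if "k \<le> m" for k
    using that
  proof (induction k)
    case (Suc k)
    let ?c = "3 * k + lower (g k)" and ?d = "3 * k + upper (g k)"
    have g: "g k < 3" using assms Suc.prems by auto
    have step: "indep (elim (elims g A k) ?c ?d) (?S (Suc k) a) \<longleftrightarrow>
        (\<exists>b. (b = lower (g k) \<or> b = upper (g k)) \<and> indep (elims g A k) (?S k (a(k := b))))" for a
    proof -
      have "?S k (a(k := b)) = insert (3 * k + b) (?S (Suc k) a)" for b
      proof -
        have "{k..<m} = insert k {Suc k..<m}" using Suc.prems by auto
        then show ?thesis by (auto simp: image_iff)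
      qed
      then show ?thesis
        by (subst indep_elim) (auto intro: symp_elims assms)
    qed
    have "(\<exists>a. ?V a \<and> indep (elims g A k) (?S k a)) \<longleftrightarrow>
        (\<exists>a. ?V a \<and> (\<exists>b. (b < 3 \<and> b \<noteq> g k) \<and> indep (elims g A k) (?S k (a(k := b)))))"
      (is "?L \<longleftrightarrow> ?R")
    proof
      assume ?L
      then obtain a where "?V a" "indep (elims g A k) (?S k a)" by blast
      then show ?R using Suc.prems by (intro exI[of _ a] conjI exI[of _ "a k"]) auto
    next
      assume ?R
      then obtain a b where "?V a" "b < 3 \<and> b \<noteq> g k" "indep (elims g A k) (?S k (a(k := b)))" by blast
      then show ?L by (intro exI[of _ "a(k := b)"]) auto
    qed
    then show ?case using Suc by (simp add: step lower_upper[OF g])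
  qed simp
  from this[of m] have "(\<exists>a. ?V a \<and> indep A (?S 0 a)) \<longleftrightarrow> (\<exists>a. ?V a) \<and> \<not> elims g A m z z"
    by (auto simp: indep_def)
  \<comment> \<open>The assignment no longer occurs in the independent set; any admissible one
    witnesses the remaining existential.\<close>
  moreover have "?V (\<lambda>i. lower (g i))" using assms lower_upper by blast
  ultimately show ?thesis by (auto simp: lessThan_atLeast0)
qed

section \<open>Guesses as numbers in base 3\<close>

definition digit :: "nat \<Rightarrow> nat \<Rightarrow> nat" where
  "digit d j = d div 3 ^ j mod 3"

lemma digit_less: "digit d j < 3"
  by (simp add: digit_def)

lemma ex_digits:
  assumes "\<forall>j<P. f j < 3"
  shows "\<exists>d<3 ^ P. \<forall>j<P. digit d j = f j"
  using assms
proof (induction P)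
  case (Suc P)
  then obtain d where d: "d < 3 ^ P" "\<forall>j<P. digit d j = f j" by auto
  have f: "f P < 3" using Suc.prems by simp
  have "d + 3 ^ P * f P < 3 ^ P * (1 + f P)" using d by simp
  also have "\<dots> \<le> 3 ^ P * 3" using f by (intro mult_left_mono) auto
  finally have "d + 3 ^ P * f P < 3 ^ Suc P" by simp
  moreover have "digit (d + 3 ^ P * f P) j = f j" if "j < Suc P" for j
  proof (cases "j = P")
    case True
    with d f show ?thesis by (simp add: digit_def)
  next
    case False
    with that have "j < P" by simp
    \<comment> \<open>Splitting off one more factor 3 shows that, after division by 3^j, the new top
      digit contributes a multiple of 3.\<close>
    then have "(3::nat) ^ P = 3 ^ j * (3 * 3 ^ (P - Suc j))"
      by (metis le_add_diff_inverse Suc_leI power_Suc power_add add_Suc_shift add_Suc mult.assoc)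
    then have "d + 3 ^ P * f P = d + 3 ^ j * (3 * (3 ^ (P - Suc j) * f P))"
      by (simp only: mult.assoc)
    then have "(d + 3 ^ P * f P) div 3 ^ j = d div 3 ^ j + 3 * (3 ^ (P - Suc j) * f P)"
      by (simp only: div_mult_self2 power_not_zero) simp
    then show ?thesis using d \<open>j < P\<close> by (simp add: digit_def)
  qed
  ultimately show ?case by blast
qed simp

section \<open>Multilinear monomials as independent sets of candidates\<close>

definition cand :: "psp \<Rightarrow> nat \<Rightarrow> prod_term option" where
  "cand F u = (if u div 3 < length F \<and> u mod 3 < length (F ! (u div 3))
     then Some (F ! (u div 3) ! (u mod 3)) else None)"

definition cand_vars :: "psp \<Rightarrow> nat \<Rightarrow> nat list" where
  "cand_vars F u = (case cand F u of None \<Rightarrow> [] | Some T \<Rightarrow> T)"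

text \<open>A clause with fewer than three terms keeps vacant positions, so that every clause has
  exactly three candidates; a vacant one must never be chosen.\<close>

definition unusable :: "psp \<Rightarrow> nat \<Rightarrow> bool" where
  "unusable F u \<longleftrightarrow> cand F u = None \<or> \<not> distinct (cand_vars F u)"

text \<open>Unusable candidates get a loop. The bound on u exempts the vertex
  \<open>3 * length F\<close>, which has no term either. Terms of one clause may conflict too: a
  choice takes only one of them, and clause numbers need not be compared.\<close>

definition conflict :: "psp \<Rightarrow> nat \<Rightarrow> nat \<Rightarrow> bool" where
  "conflict F u v \<longleftrightarrow>
     (if u = v then u < 3 * length F \<and> unusable F u
      else set (cand_vars F u) \<inter> set (cand_vars F v) \<noteq> {})"

lemma symp_conflict: "symp (conflict F)"
  by (auto simp: symp_def conflict_def)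

lemma multilinear_concat: "multilinear (\<Sum>T\<leftarrow>Ts. mset T) \<longleftrightarrow> distinct (concat Ts)"
proof -
  have "(\<Sum>T\<leftarrow>Ts. mset T) = mset (concat Ts)" by (induction Ts) auto
  then show ?thesis
    by (auto simp: multilinear_def distinct_count_atmost_1 not_in_iff count_eq_zero_iff)
qed

lemma distinct_concat_iff_nth:
  "distinct (concat Ts) \<longleftrightarrow>
     (\<forall>i<length Ts. distinct (Ts ! i)) \<and>
     (\<forall>i<length Ts. \<forall>j<length Ts. i \<noteq> j \<longrightarrow> set (Ts ! i) \<inter> set (Ts ! j) = {})"
proof (induction Ts)
  case (Cons T Ts)
  have "set T \<inter> set (concat Ts) = {} \<longleftrightarrow> (\<forall>j<length Ts. set T \<inter> set (Ts ! j) = {})"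
    by (auto simp: set_conv_nth[of Ts])
  moreover have "(\<forall>j<length Ts. set (Ts ! j) \<inter> set T = {}) \<longleftrightarrow> (\<forall>j<length Ts. set T \<inter> set (Ts ! j) = {})"
    by (simp add: Int_commute)
  ultimately show ?case
    by (simp del: set_concat add: Cons.IH All_less_Suc2 all_conj_distrib imp_conjR) argo
qed simp

text \<open>
  The additional vertex 3 * length F is in conflict with nothing at first. It keeps the sets to
  which elimination is applied nonempty, and ends up in conflict with itself if there is no solution.
\<close>

lemma has_multilinear_monomial_iff:
  assumes F: "\<forall>C\<in>set F. length C \<le> 3"
  shows "has_multilinear_monomial F \<longleftrightarrow>
    (\<exists>a. (\<forall>i<length F. a i < 3) \<and>
      indep (conflict F) (insert (3 * length F) ((\<lambda>i. 3 * i + a i) ` {..<length F})))"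
    (is "_ \<longleftrightarrow> (\<exists>a. ?V a \<and> ?I a)")
proof -
  let ?m = "length F"
  let ?T = "\<lambda>a i. cand_vars F (3 * i + a i)"
  have top: "cand F (3 * ?m) = None" "cand_vars F (3 * ?m) = []"
    by (auto simp: cand_def cand_vars_def)
  have I: "?I a \<longleftrightarrow> (\<forall>i<?m. a i < length (F ! i) \<and> distinct (F ! i ! a i)) \<and>
      (\<forall>i<?m. \<forall>j<?m. i \<noteq> j \<longrightarrow> set (F ! i ! a i) \<inter> set (F ! j ! a j) = {})" (is "_ \<longleftrightarrow> ?J a")
    if V: "?V a" for a
  proof -
    have c: "cand F (3 * i + a i) = (if a i < length (F ! i) then Some (F ! i ! a i) else None)"
      if "i < ?m" for i
      using that V by (simp add: cand_def)
    have ne: "3 * i + a i \<noteq> 3 * ?m" "3 * i + a i < 3 * ?m" if "i < ?m" for i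
      using that V[rule_format, OF that] by linarith+
    have eq: "3 * i + a i = 3 * j + a j \<longleftrightarrow> i = j" if "i < ?m" "j < ?m" for i j
    proof -
      have "i = (3 * i + a i) div 3" "j = (3 * j + a j) div 3" using that V by simp_all
      then show ?thesis by metis
    qed
    have "?I a \<longleftrightarrow> (\<forall>i<?m. \<forall>j<?m. \<not> conflict F (3 * i + a i) (3 * j + a j))"
    proof -
      have z: "\<not> conflict F u (3 * ?m)" "\<not> conflict F (3 * ?m) u" for u
        by (auto simp: conflict_def top)
      show ?thesis by (simp add: indep_def z) blast
    qed
    also have "\<dots> \<longleftrightarrow> (\<forall>i<?m. \<not> unusable F (3 * i + a i)) \<and>
        (\<forall>i<?m. \<forall>j<?m. i \<noteq> j \<longrightarrow> set (?T a i) \<inter> set (?T a j) = {})"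
    proof -
      have "conflict F (3 * i + a i) (3 * j + a j) \<longleftrightarrow>
          (if i = j then unusable F (3 * i + a i) else set (?T a i) \<inter> set (?T a j) \<noteq> {})"
        if "i < ?m" "j < ?m" for i j
        using ne[OF that(1)] eq[OF that] by (auto simp: conflict_def)
      then have "(\<forall>i<?m. \<forall>j<?m. \<not> conflict F (3 * i + a i) (3 * j + a j)) \<longleftrightarrow>
          (\<forall>i<?m. \<forall>j<?m. \<not> (if i = j then unusable F (3 * i + a i)
             else set (?T a i) \<inter> set (?T a j) \<noteq> {}))" by simp
      also have "\<dots> \<longleftrightarrow> (\<forall>i<?m. \<not> unusable F (3 * i + a i)) \<and>
          (\<forall>i<?m. \<forall>j<?m. i \<noteq> j \<longrightarrow> set (?T a i) \<inter> set (?T a j) = {})" by auto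
      finally show ?thesis .
    qed
    also have "\<dots> \<longleftrightarrow> ?J a"
    proof -
      have "\<not> unusable F (3 * i + a i) \<longleftrightarrow> a i < length (F ! i) \<and> distinct (F ! i ! a i)"
        if "i < ?m" for i
        using c[OF that] by (simp add: unusable_def cand_vars_def)
      moreover have "?T a i = F ! i ! a i" if "i < ?m" "a i < length (F ! i)" for i
        using c[OF that(1)] that(2) by (simp add: cand_vars_def)
      ultimately show ?thesis by (intro conj_cong) simp_all
    qed
    finally show ?thesis .
  qed
  have "has_multilinear_monomial F \<longleftrightarrow>
      (\<exists>Ts. list_all2 (\<lambda>T C. T \<in> set C) Ts F \<and> distinct (concat Ts))"
    by (auto simp: has_multilinear_monomial_def expansion_monomials_def multilinear_concat)
  also have "\<dots> \<longleftrightarrow> (\<exists>a. ?V a \<and> ?J a)"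
  proof
    assume "\<exists>Ts. list_all2 (\<lambda>T C. T \<in> set C) Ts F \<and> distinct (concat Ts)"
    then obtain Ts where Ts: "list_all2 (\<lambda>T C. T \<in> set C) Ts F" "distinct (concat Ts)" by blast
    then have "\<forall>i<?m. \<exists>k<length (F ! i). Ts ! i = F ! i ! k"
      by (metis list_all2_conv_all_nth in_set_conv_nth)
    then obtain a where a: "\<forall>i<?m. a i < length (F ! i) \<and> Ts ! i = F ! i ! a i" by metis
    have "length Ts = ?m" using Ts(1) by (rule list_all2_lengthD)
    with a Ts(2) have "?J a" unfolding distinct_concat_iff_nth by simp
    moreover have "?V a" using a F by (meson nth_mem less_le_trans)
    ultimately show "\<exists>a. ?V a \<and> ?J a" by blast
  next
    assume "\<exists>a. ?V a \<and> ?J a"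
    then obtain a where J: "?J a" by blast
    let ?Ts = "map (\<lambda>i. F ! i ! a i) [0..<?m]"
    have "list_all2 (\<lambda>T C. T \<in> set C) ?Ts F" using J by (auto simp: list_all2_conv_all_nth)
    moreover have "distinct (concat ?Ts)" using J by (auto simp: distinct_concat_iff_nth)
    ultimately show "\<exists>Ts. list_all2 (\<lambda>T C. T \<in> set C) Ts F \<and> distinct (concat Ts)" by blast
  qed
  also have "\<dots> \<longleftrightarrow> (\<exists>a. ?V a \<and> ?I a)" by (rule ex_cong1, rule conj_cong[OF refl], rule I[symmetric])
  finally show ?thesis .
qed

lemma has_multilinear_monomial_elims:
  assumes F: "\<forall>C\<in>set F. length C \<le> 3" and m: "m = length F"
  shows "has_multilinear_monomial F \<longleftrightarrow>
    (\<exists>d<3 ^ ((m + 1) div 2). \<not> elims (\<lambda>i. digit d (i div 2)) (conflict F) m (3 * m) (3 * m))"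
proof -
  let ?P = "(m + 1) div 2"
  let ?I = "\<lambda>a. indep (conflict F) (insert (3 * m) ((\<lambda>i. 3 * i + a i) ` {..<m}))"
  have "(\<exists>a. (\<forall>i<m. a i < 3) \<and> ?I a) \<longleftrightarrow>
      (\<exists>d<3 ^ ?P. \<exists>a. (\<forall>i<m. a i < 3 \<and> a i \<noteq> digit d (i div 2)) \<and> ?I a)"
  proof
    assume "\<exists>a. (\<forall>i<m. a i < 3) \<and> ?I a"
    then obtain a where a: "\<forall>i<m. a i < 3" "?I a" by blast
    \<comment> \<open>The claim is made for arbitrary x and y because for odd m the last pair reads
      \<open>a m\<close>, about which nothing is known.\<close>
    have "\<exists>g<3. g \<noteq> x \<and> g \<noteq> y" for x y :: nat
    proof -
      have "card {x, y} < card {..<3::nat}" by (simp add: card_insert_if)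
      then have "\<not> {..<3} \<subseteq> {x, y}" using card_mono[of "{x, y}" "{..<3}"] by auto
      then show ?thesis by auto
    qed
    then have "\<forall>j. \<exists>g<3. g \<noteq> a (2 * j) \<and> g \<noteq> a (2 * j + 1)" by blast
    then obtain g where g: "g j < 3" "g j \<noteq> a (2 * j)" "g j \<noteq> a (2 * j + 1)" for j by metis
    obtain d where d: "d < 3 ^ ?P" "\<forall>j<?P. digit d j = g j"
      using ex_digits[of ?P g] g(1) by blast
    have "a i \<noteq> digit d (i div 2)" if "i < m" for i
    proof -
      have "digit d (i div 2) = g (i div 2)" using d that by auto
      moreover have "i = 2 * (i div 2) \<or> i = 2 * (i div 2) + 1" by linarith
      ultimately show ?thesis using g(2,3)[of "i div 2"] by metis
    qed
    with a d show "\<exists>d<3 ^ ?P. \<exists>a. (\<forall>i<m. a i < 3 \<and> a i \<noteq> digit d (i div 2)) \<and> ?I a" by blast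
  qed blast
  then show ?thesis
    unfolding has_multilinear_monomial_iff[OF F] m[symmetric]
    by (simp add: elims_complete symp_conflict digit_less)
qed

section \<open>Weakest preconditions with step counts\<close>

text \<open>Execution is deterministic, so exhibiting one halting run is total correctness. The step
  count is an argument of the postcondition, so that result and running time are verified
  together.\<close>

definition wp :: "com \<Rightarrow> (nat \<Rightarrow> (nat \<Rightarrow> nat) \<Rightarrow> (nat \<Rightarrow> nat) \<Rightarrow> bool) \<Rightarrow>
    (nat \<Rightarrow> nat) \<Rightarrow> (nat \<Rightarrow> nat) \<Rightarrow> bool" where
  "wp p Q r h \<longleftrightarrow> (\<exists>k r' h'. exec p (r, h) k (r', h') \<and> Q k r' h')"

lemma wp_simps [simp]:
  "wp (Const i c) Q r h \<longleftrightarrow> Q 1 (r(i := c)) h"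
  "wp (Add i j l) Q r h \<longleftrightarrow> Q 1 (r(i := r j + r l)) h"
  "wp (Sub i j l) Q r h \<longleftrightarrow> Q 1 (r(i := r j - r l)) h"
  "wp (Load i j) Q r h \<longleftrightarrow> Q 1 (r(i := h (r j))) h"
  "wp (Store i j) Q r h \<longleftrightarrow> Q 1 r (h(r i := r j))"
  unfolding wp_def by (auto elim: exec_elims intro: exec.intros(1-5)[unfolded One_nat_def])

lemma wp_Seq [simp]: "wp (Seq p q) Q r h \<longleftrightarrow> wp p (\<lambda>k. wp q (\<lambda>l. Q (k + l))) r h"
  unfolding wp_def by (fastforce elim: exec_elims intro: exec.intros)

lemma wp_IfPos [simp]:
  "wp (IfPos i p q) Q r h \<longleftrightarrow> wp (if r i > 0 then p else q) (\<lambda>k. Q (Suc k)) r h"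
proof (cases "r i > 0")
  case True
  then show ?thesis
    unfolding wp_def using exec.IfTrue[of r i, OF True] by (auto elim!: exec_elims(7)) blast+
next
  case False
  then have "r i = 0" by simp
  then show ?thesis
    unfolding wp_def using exec.IfFalse by (auto elim!: exec_elims(7)) blast+
qed

lemma wp_mono: "wp p Q r h \<Longrightarrow> (\<And>k r' h'. Q k r' h' \<Longrightarrow> Q' k r' h') \<Longrightarrow> wp p Q' r h"
  unfolding wp_def by blast

text \<open>The invariant is indexed by the number of completed iterations, and their total n is
  fixed in advance; this gives termination and time in one induction. Each iteration pays for its
  body and one test, and the failing test adds 1.\<close>

lemma wp_While:
  assumes "I 0 r h"
    and "\<And>j r h. j < n \<Longrightarrow> I j r h \<Longrightarrow> r i > 0"
    and "\<And>j r h. j < n \<Longrightarrow> I j r h \<Longrightarrow> wp p (\<lambda>k r' h'. k \<le> b \<and> I (Suc j) r' h') r h"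
    and "\<And>r h. I n r h \<Longrightarrow> r i = 0"
    and Q: "\<And>k r h. k \<le> n * (b + 1) + 1 \<Longrightarrow> I n r h \<Longrightarrow> Q k r h"
  shows "wp (WhilePos i p) Q r h"
proof -
  have "wp (WhilePos i p) (\<lambda>k r' h'. k \<le> l * (b + 1) + 1 \<and> I n r' h') r h"
    if "I (n - l) r h" "l \<le> n" for l r h
    using that
  proof (induction l arbitrary: r h)
    case 0
    then have "r i = 0" using assms(4) by simp
    then have "exec (WhilePos i p) (r, h) 1 (r, h)" by (rule exec.WhileFalse)
    with 0 show ?case unfolding wp_def by auto
  next
    case (Suc l)
    then have j: "n - Suc l < n" "Suc (n - Suc l) = n - l" by auto
    obtain k r' h' where k: "exec p (r, h) k (r', h')" "k \<le> b" "I (n - l) r' h'"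
      using assms(3)[OF j(1) Suc.prems(1)] j(2) unfolding wp_def by auto
    obtain k' r'' h'' where k': "exec (WhilePos i p) (r', h') k' (r'', h'')"
      "k' \<le> l * (b + 1) + 1" "I n r'' h''"
      using Suc.IH[OF k(3)] Suc.prems(2) unfolding wp_def by auto
    have "exec (WhilePos i p) (r, h) (Suc (k + k')) (r'', h'')"
      using assms(2)[OF j(1) Suc.prems(1)] k(1) k'(1) by (rule exec.WhileTrue)
    then show ?case using k k' unfolding wp_def by fastforce
  qed
  from this[of n] assms(1)
  have "wp (WhilePos i p) (\<lambda>k r' h'. k \<le> n * (b + 1) + 1 \<and> I n r' h') r h" by simp
  then show ?thesis by (rule wp_mono) (blast intro: Q)
qed

lemma wp_for:
  assumes "r i = n" "I 0 r h"
    and step: "\<And>j r h. j < n \<Longrightarrow> r i = n - j \<Longrightarrow> I j r h \<Longrightarrow>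
      wp p (\<lambda>k r' h'. k \<le> b \<and> r' i = n - Suc j \<and> I (Suc j) r' h') r h"
    and "\<And>k r h. k \<le> n * (b + 1) + 1 \<Longrightarrow> I n r h \<Longrightarrow> Q k r h"
  shows "wp (WhilePos i p) Q r h"
  using assms by (intro wp_While[where I = "\<lambda>j r h. r i = n - j \<and> I j r h" and n = n and b = b]) auto

notation Seq (infixr ";;" 60)

section \<open>Reading the input\<close>

text \<open>
  Registers below 14 are global: 0 answer, 2 number m of clauses, 3 constant 0, 4 length L of the
  input, 5 to 12 the layout of the memory computed in the program layout below, 13 constant 1.
  A program called by another one works on higher registers, apart from those that pass arguments
  and results, so that its specification can say what it leaves alone by a bound on the register.

  The program scan runs twice. The address of each term is written to a table that starts at the
  address in register 14 and advances by the value of register 15 per entry. The end of the input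
  is known only after the first run, which therefore has 0 in both registers and writes everything
  to cell 0, where the number n of variables was.
\<close>

definition scan_clause :: com where
  "scan_clause = WhilePos 18
     (Store 19 16 ;; Add 19 19 15 ;; Load 20 16 ;; Add 16 16 20 ;; Add 16 16 13 ;; Sub 18 18 13)"

definition scan :: com where
  "scan = Const 16 2 ;; Add 17 2 3 ;;
     WhilePos 17
      (Load 18 16 ;; Add 16 16 13 ;; Add 19 14 3 ;; scan_clause ;;
       Add 14 14 15 ;; Add 14 14 15 ;; Add 14 14 15 ;; Sub 17 17 13)"

text \<open>Address 0 is excluded because a table entry 0 will mean that the position is
  vacant.\<close>

definition located :: "nat list \<Rightarrow> nat \<Rightarrow> nat list \<Rightarrow> bool" where
  "located xs q ys \<longleftrightarrow> 0 < q \<and> (\<exists>ps zs. xs = ps @ ys @ zs \<and> length ps = q)"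

text \<open>The assumption on registers 19 and 15 covers both runs: either all writes go to cell 0,
  or the table lies behind the input. In both cases the input at positive addresses survives the
  writes.\<close>

lemma wp_scan_clause:
  assumes r: "r 13 = 1" "r 18 = length C" "r 16 = length ps" "0 < r 16"
    and xs: "xs = ps @ concat (map encode_term C) @ zs"
    and d: "r 19 = 0 \<and> r 15 = 0 \<or> length xs \<le> r 19"
    and h: "\<forall>a. 0 < a \<and> a < length xs \<longrightarrow> h a = xs ! a"
    and Q: "\<And>k r' h'. k \<le> 7 * length C + 1 \<Longrightarrow>
      (\<exists>ps'. xs = ps' @ zs \<and> r' 16 = length ps' \<and> 0 < r' 16) \<Longrightarrow>
      \<forall>x<18. x \<noteq> 16 \<longrightarrow> r' x = r x \<Longrightarrow>
      \<forall>x. (\<forall>a<length C. x \<noteq> r 19 + r 15 * a) \<longrightarrow> h' x = h x \<Longrightarrow>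
      r 15 = 1 \<longrightarrow> (\<forall>a<length C. located xs (h' (r 19 + a)) (encode_term (C ! a))) \<Longrightarrow>
      Q k r' h'"
  shows "wp scan_clause Q r h"
  unfolding scan_clause_def
proof (rule wp_for[where n = "length C" and b = 6 and I = "\<lambda>j r' h'.
      (\<exists>ps'. xs = ps' @ concat (map encode_term (drop j C)) @ zs \<and> r' 16 = length ps' \<and> 0 < r' 16) \<and>
      r' 19 = r 19 + r 15 * j \<and> (\<forall>x<18. x \<noteq> 16 \<longrightarrow> r' x = r x) \<and>
      (\<forall>x. (\<forall>a<j. x \<noteq> r 19 + r 15 * a) \<longrightarrow> h' x = h x) \<and>
      (r 15 = 1 \<longrightarrow> (\<forall>a<j. located xs (h' (r 19 + a)) (encode_term (C ! a))))"], goal_cases)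
  case 1
  then show ?case by (rule r)
next
  case 2
  then show ?case using r xs by auto
next
  case (3 j r' h')
  from 3 obtain ps' where ps': "xs = ps' @ concat (map encode_term (drop j C)) @ zs"
    "r' 16 = length ps'" "0 < r' 16" by blast
  have C: "drop j C = C ! j # drop (Suc j) C" using 3 by (simp add: Cons_nth_drop_Suc)
  have p: "length ps' < length xs" using ps'(1) by (simp add: C encode_term_def)
  have d': "r' 19 = 0 \<and> r' 15 = 0 \<or> length xs \<le> r' 19"
    using d 3 by auto
  \<comment> \<open>The address is stored before the length of the term is loaded, so the store must
    not hit that length.\<close>
  have ne: "r' 19 \<noteq> length ps'" using d' p ps' by linarith
  have "h' (length ps') = xs ! length ps'"
  proof -
    have "length ps' \<noteq> r 19 + r 15 * a" for a using d p ps'(2,3) by auto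
    then show ?thesis using 3 h p ps'(2,3) by auto
  qed
  also have "\<dots> = length (C ! j)" by (subst ps'(1)) (simp add: C encode_term_def)
  finally have len: "h' (length ps') = length (C ! j)" .
  have split: "xs = (ps' @ encode_term (C ! j)) @ concat (map encode_term (drop (Suc j) C)) @ zs"
    using ps'(1) by (simp add: C)
  have loc: "located xs (length ps') (encode_term (C ! j))"
    unfolding located_def using ps' C by auto
  have r': "r' 13 = 1" "r' 15 = r 15" "r' 19 = r 19 + r 15 * j" using 3 r by auto
  from 3(3) have tab: "r 15 = 1 \<longrightarrow> (\<forall>a<j. located xs (h' (r 19 + a)) (encode_term (C ! a)))"
    by blast
  show ?case
    using 3 ps'(2,3) ne len r'
    apply (simp add: algebra_simps)
    apply (intro conjI)
    subgoal by (rule exI[of _ "ps' @ encode_term (C ! j)"]) (use split in \<open>simp add: encode_term_def\<close>)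
    subgoal using loc by simp
    done
next
  case (4 k r' h')
  then show ?case by (intro Q) auto
qed

text \<open>The table pointer advances by three entries per clause whatever the length of the
  clause. Hence candidate \<open>3 * i + a\<close> always has that offset, and vacant entries keep
  their old value. Terms are skipped by their length field, so the time does not depend on
  t.\<close>

lemma wp_scan:
  assumes r: "r 13 = 1" "r 3 = 0" "r 2 = length F"
    and F: "\<forall>C\<in>set F. length C \<le> 3"
    and xs: "xs = encode_psp n F"
    and d: "r 14 = 0 \<and> r 15 = 0 \<or> length xs \<le> r 14"
    and h: "\<forall>a. 0 < a \<and> a < length xs \<longrightarrow> h a = xs ! a"
    and Q: "\<And>k r' h'. k \<le> 30 * length F + 3 \<Longrightarrow>
      r' 16 = length xs \<Longrightarrow> r' 14 = r 14 + r 15 * (3 * length F) \<Longrightarrow>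
      \<forall>x<14. r' x = r x \<Longrightarrow>
      \<forall>x. (\<forall>i<length F. \<forall>a<length (F ! i). x \<noteq> r 14 + r 15 * (3 * i + a)) \<longrightarrow> h' x = h x \<Longrightarrow>
      r 15 = 1 \<longrightarrow> (\<forall>i<length F. \<forall>a<length (F ! i).
         located xs (h' (r 14 + (3 * i + a))) (encode_term (F ! i ! a))) \<Longrightarrow>
      Q k r' h'"
  shows "wp scan Q r h"
  unfolding scan_def
  apply (simp add: r)
proof (rule wp_for[where n = "length F" and b = 29 and I = "\<lambda>j r' h'.
      (\<exists>ps'. xs = ps' @ concat (map encode_clause (drop j F)) \<and> r' 16 = length ps' \<and> 0 < r' 16) \<and>
      r' 14 = r 14 + r 15 * (3 * j) \<and> r' 15 = r 15 \<and> (\<forall>x<14. r' x = r x) \<and>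
      (\<forall>x. (\<forall>i<j. \<forall>a<length (F ! i). x \<noteq> r 14 + r 15 * (3 * i + a)) \<longrightarrow> h' x = h x) \<and>
      (r 15 = 1 \<longrightarrow> (\<forall>i<j. \<forall>a<length (F ! i).
         located xs (h' (r 14 + (3 * i + a))) (encode_term (F ! i ! a))))"], goal_cases)
  case 1
  then show ?case by simp
next
  case 2
  then show ?case
    by (auto simp: xs encode_psp_def intro!: exI[of _ "[n, length F]"])
next
  case (3 j r' h')
  from 3 obtain ps' where ps': "xs = ps' @ concat (map encode_clause (drop j F))"
    "r' 16 = length ps'" "0 < r' 16" by blast
  let ?C = "F ! j"
  let ?zs = "concat (map encode_clause (drop (Suc j) F))"
  have C: "drop j F = ?C # drop (Suc j) F" using 3 by (simp add: Cons_nth_drop_Suc)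
  have split: "xs = (ps' @ [length ?C]) @ concat (map encode_term ?C) @ ?zs"
    using ps'(1) by (simp add: C encode_clause_def)
  have p: "length ps' < length xs" by (subst split) simp
  have h': "\<forall>a. 0 < a \<and> a < length xs \<longrightarrow> h' a = xs ! a"
  proof (intro allI impI)
    fix a assume a: "0 < a \<and> a < length xs"
    then have "a \<noteq> r 14 + r 15 * (3 * i + b)" for i b using d by auto
    then show "h' a = xs ! a" using 3 h a by auto
  qed
  have len: "h' (length ps') = length ?C"
    using h' p ps'(2,3) by (subst (asm) (2) split) (simp add: nth_append)
  have r': "r' 13 = 1" "r' 3 = 0" "r' 15 = r 15" "r' 14 = r 14 + r 15 * (3 * j)" using 3 r by auto
  have C3: "length ?C \<le> 3" using F 3 by simp
  show ?case
    apply (simp add: r' ps'(2) len)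
  proof (rule wp_scan_clause[where C = ?C and xs = xs and zs = ?zs and ps = "ps' @ [length ?C]"],
      goal_cases)
    case 5
    show ?case by (rule split)
  next
    case 7
    show ?case by (rule h')
  next
    case (8 k r'' h'')
    have k: "k \<le> 22" using 8(1) C3 by linarith
    have R: "r'' 17 = length F - j" "r'' 13 = 1" "r'' 14 = r 14 + r 15 * (3 * j)" "r'' 15 = r 15"
      "\<forall>x<14. r'' x = r x" using 8(3) 3 r r' by auto
    have H: "\<forall>x. (\<forall>a<length ?C. x \<noteq> r 14 + r 15 * (3 * j + a)) \<longrightarrow> h'' x = h' x"
      using 8(4) r' by (simp add: algebra_simps)
    have T: "r 15 = 1 \<longrightarrow> (\<forall>a<length ?C.
        located xs (h'' (r 14 + (3 * j + a))) (encode_term (?C ! a)))"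
      using 8(5) r' by (simp add: algebra_simps)
    have H': "\<forall>x. (\<forall>i<Suc j. \<forall>a<length (F ! i). x \<noteq> r 14 + r 15 * (3 * i + a)) \<longrightarrow> h'' x = h x"
      using H 3 by simp
    have T': "r 15 = 1 \<longrightarrow> (\<forall>i<Suc j. \<forall>a<length (F ! i).
         located xs (h'' (r 14 + (3 * i + a))) (encode_term (F ! i ! a)))"
    proof (intro allI impI)
      fix i a assume a: "r 15 = 1" "i < Suc j" "a < length (F ! i)"
      show "located xs (h'' (r 14 + (3 * i + a))) (encode_term (F ! i ! a))"
      proof (cases "i = j")
        case True
        then show ?thesis using T a by simp
      next
        case False
        then have i: "i < j" using a by simp
        \<comment> \<open>This keeps the entries of clause i below those that clause j has just
          written.\<close>
        have "length (F ! i) \<le> 3" using F i 3 by simp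
        then have "h'' (r 14 + (3 * i + a)) = h' (r 14 + (3 * i + a))"
          using H a i by simp
        then show ?thesis using 3 a i by simp
      qed
    qed
    have R': "r'' 14 + r'' 15 + r'' 15 + r'' 15 = r 14 + r 15 * (3 + 3 * j)"
      using R by (simp add: algebra_simps)
    have "r'' 17 - r'' 13 = length F - Suc j" using R by simp
    then show ?case using 8(2) k R(4,5) R' H' T' by simp
  qed (use d r' in auto)
next
  case (4 k r' h')
  then show ?case by (intro Q) (auto simp: algebra_simps)
qed

section \<open>The conflict matrix\<close>

text \<open>
  The mark of variable x is cell B + x, where B is in register 9. Row u of the conflict matrix uses
  u + 1 as its mark, so that the marks left by earlier rows need not be erased.
\<close>

definition mark :: com where
  "mark = WhilePos 25
     (Add 24 24 13 ;; Load 26 24 ;; Add 26 9 26 ;; Load 27 26 ;; Sub 27 27 15 ;;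
      IfPos 27 (Const 18 1) (Const 27 0) ;; Add 27 15 13 ;; Store 26 27 ;; Sub 25 25 13)"

text \<open>There is no skip instruction; the idle branch clears a scratch register.\<close>

definition check :: com where
  "check = WhilePos 25
     (Add 24 24 13 ;; Load 26 24 ;; Add 26 9 26 ;; Load 27 26 ;; Sub 27 27 15 ;;
      IfPos 27 (Const 22 1) (Const 27 0) ;; Sub 25 25 13)"

definition vars_at :: "(nat \<Rightarrow> nat) \<Rightarrow> nat \<Rightarrow> nat list \<Rightarrow> bool" where
  "vars_at h q T \<longleftrightarrow> h q = length T \<and> (\<forall>j<length T. h (q + Suc j) = T ! j)"

lemma vars_at_cong:
  assumes "vars_at h q T" "q + length T < B" "\<forall>a<B. h' a = h a"
  shows "vars_at h' q T"
  using assms by (simp add: vars_at_def)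

text \<open>One pass marks the variables and detects repetitions: a variable found already marked
  has occurred earlier in T. Older marks are at most u, so the truncated difference with u is
  positive only for marks of the current row.\<close>

lemma wp_mark:
  assumes r: "r 13 = 1" "r 24 = q" "r 25 = length T" "r 9 = B" "r 15 = u"
    and T: "vars_at h q T" "q + length T < B"
    and h: "\<forall>a\<ge>B. h a \<le> u"
    and Q: "\<And>k r' h'. k \<le> 11 * length T + 1 \<Longrightarrow> \<forall>x<24. x \<noteq> 18 \<longrightarrow> r' x = r x \<Longrightarrow>
      r' 18 > 0 \<longleftrightarrow> r 18 > 0 \<or> \<not> distinct T \<Longrightarrow>
      \<forall>a<B. h' a = h a \<Longrightarrow> \<forall>x. h' (B + x) > u \<longleftrightarrow> x \<in> set T \<Longrightarrow>
      \<forall>a\<ge>B. h' a \<le> Suc u \<Longrightarrow> Q k r' h'"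
  shows "wp mark Q r h"
  unfolding mark_def
proof (rule wp_for[where n = "length T" and b = 10 and I = "\<lambda>j r' h'.
      r' 24 = q + j \<and> (\<forall>x<24. x \<noteq> 18 \<longrightarrow> r' x = r x) \<and>
      (r' 18 > 0 \<longleftrightarrow> r 18 > 0 \<or> \<not> distinct (take j T)) \<and>
      (\<forall>a<B. h' a = h a) \<and> (\<forall>x. h' (B + x) > u \<longleftrightarrow> x \<in> set (take j T)) \<and>
      (\<forall>a\<ge>B. h' a \<le> Suc u)"], goal_cases)
  case 2
  then show ?case using r h by (auto simp: le_SucI not_less)
next
  case (3 j r' h')
  have x: "h' (Suc (q + j)) = T ! j" using 3 T by (simp add: vars_at_def)
  have take: "take (Suc j) T = take j T @ [T ! j]" using 3 by (simp add: take_Suc_conv_app_nth)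
  show ?case using 3 r x by (auto simp: take)
next
  case (4 k r' h')
  then show ?case by (intro Q) auto
qed (rule r)

lemma wp_check:
  assumes r: "r 13 = 1" "r 24 = q" "r 25 = length T" "r 9 = B" "r 15 = u"
    and T: "vars_at h q T"
    and Q: "\<And>k r'. k \<le> 9 * length T + 1 \<Longrightarrow> \<forall>x<24. x \<noteq> 22 \<longrightarrow> r' x = r x \<Longrightarrow>
      r' 22 > 0 \<longleftrightarrow> r 22 > 0 \<or> (\<exists>x\<in>set T. h (B + x) > u) \<Longrightarrow> Q k r' h"
  shows "wp check Q r h"
  unfolding check_def
proof (rule wp_for[where n = "length T" and b = 8 and I = "\<lambda>j r' h'.
      r' 24 = q + j \<and> (\<forall>x<24. x \<noteq> 22 \<longrightarrow> r' x = r x) \<and> h' = h \<and>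
      (r' 22 > 0 \<longleftrightarrow> r 22 > 0 \<or> (\<exists>x\<in>set (take j T). h (B + x) > u))"], goal_cases)
  case 2
  then show ?case using r by auto
next
  case (3 j r' h')
  have x: "h (Suc (q + j)) = T ! j" using 3 T by (simp add: vars_at_def)
  have take: "take (Suc j) T = take j T @ [T ! j]" using 3 by (simp add: take_Suc_conv_app_nth)
  show ?case using 3 r x by (auto simp: take)
next
  case (4 k r' h')
  then have "h' = h" by blast
  then show ?case using 4 by (auto intro!: Q)
qed (rule r)

text \<open>A vacant candidate is processed as a term of length 0 at address 0. Comparing row u with
  itself puts a meaningless value on the diagonal, which the final \<open>Store\<close> replaces by
  the loop recorded in register 18.\<close>

definition conflict_row :: com where
  "conflict_row =
     Load 24 16 ;; IfPos 24 (Const 18 0) (Const 18 1) ;; Load 25 24 ;; mark ;;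
     Add 19 6 3 ;; Add 20 4 3 ;; Add 21 17 3 ;;
     WhilePos 19
      (Load 24 20 ;; Const 22 0 ;; Load 25 24 ;; check ;; Store 21 22 ;;
       Add 20 20 13 ;; Add 21 21 13 ;; Sub 19 19 13) ;;
     Add 21 17 15 ;; Store 21 18"

lemma wp_IfPos_Const:
  "wp (IfPos i (Const l a) (Const l b)) Q r h \<longleftrightarrow> Q 2 (r(l := if r i > 0 then a else b)) h"
  by (simp add: numeral_2_eq_2)

lemma wp_conflict_row:
  assumes r: "r 13 = 1" "r 3 = 0" "r 4 = L" "r 6 = M" "r 9 = B" "r 15 = u" "r 16 = L + u" "r 17 = R"
    and u: "u < M" and R: "L + M \<le> R" "R + M \<le> B"
    and W: "\<forall>v<M. vars_at h (h (L + v)) (W v) \<and> h (L + v) + length (W v) < R \<and> length (W v) \<le> t"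
    and h: "\<forall>a\<ge>B. h a \<le> u"
    and Q: "\<And>k r' h'. k \<le> 11 * t + M * (9 * t + 9) + 12 \<Longrightarrow> \<forall>x<18. r' x = r x \<Longrightarrow>
      \<forall>a<B. \<not> (R \<le> a \<and> a < R + M) \<longrightarrow> h' a = h a \<Longrightarrow> \<forall>a\<ge>B. h' a \<le> Suc u \<Longrightarrow>
      \<forall>v<M. h' (R + v) > 0 \<longleftrightarrow>
        (if u = v then h (L + u) = 0 \<or> \<not> distinct (W u) else set (W u) \<inter> set (W v) \<noteq> {}) \<Longrightarrow>
      Q k r' h'"
  shows "wp conflict_row Q r h"
  unfolding conflict_row_def
  apply (simp add: r wp_IfPos_Const del: wp_IfPos split del: if_split)
proof (rule wp_mark[where q = "h (L + u)" and T = "W u" and B = B and u = u], goal_cases)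
  case (9 k1 r1 h1)
  have r1: "\<forall>x<18. r1 x = r x" using 9(2) by simp
  have d: "r1 18 > 0 \<longleftrightarrow> h (L + u) = 0 \<or> \<not> distinct (W u)" using 9(3) by simp
  have h1: "\<forall>a<B. h1 a = h a" by (rule 9(4))
  have W1: "vars_at h1 (h1 (L + v)) (W v)" "h1 (L + v) + length (W v) < R" if "v < M" for v
  proof -
    have *: "h1 (L + v) = h (L + v)" using h1 R that by simp
    show "h1 (L + v) + length (W v) < R" using W that * by simp
    show "vars_at h1 (h1 (L + v)) (W v)" unfolding *
      by (rule vars_at_cong[where h = h and B = B]) (use W that h1 R in auto)
  qed
  note r1 = r1[rule_format]
  show ?case
    apply (simp add: r1 r)
  proof (rule wp_for[where n = M and b = "9 * t + 8" and I = "\<lambda>j r' h'.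
      r' 20 = L + j \<and> r' 21 = R + j \<and> (\<forall>x<19. r' x = r1 x) \<and>
      (\<forall>a. \<not> (R \<le> a \<and> a < R + j) \<longrightarrow> h' a = h1 a) \<and>
      (\<forall>v<j. h' (R + v) > 0 \<longleftrightarrow> set (W u) \<inter> set (W v) \<noteq> {})"], goal_cases)
    case 1
    then show ?case by simp
  next
    case 2
    then show ?case using r by simp
  next
    case (3 j r' h')
    have low: "\<forall>a<R. h' a = h1 a" using 3 by simp
    have q: "h' (L + j) = h1 (L + j)" using low R 3 by simp
    have T: "vars_at h' (h1 (L + j)) (W j)"
      by (rule vars_at_cong[where h = h1 and B = R]) (use W1 3 low in auto)
    have r': "r' 20 = L + j" "r' 21 = R + j" "r' 19 = M - j" using 3 by auto
    have rr: "r' x = r x" if "x < 18" for x using 3 that by (simp add: r1)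
    have len: "length (W j) \<le> t" using W 3 by simp
    have up: "h' (B + x) = h1 (B + x)" for x using 3 R by simp
    show ?case
      apply (simp add: r' q)
    proof (rule wp_check[where q = "h1 (L + j)" and T = "W j" and B = B and u = u], goal_cases)
      case 3
      then show ?case using T by (simp add: vars_at_def)
    next
      case (7 k r'')
      have "r'' 22 > 0 \<longleftrightarrow> set (W u) \<inter> set (W j) \<noteq> {}"
        using 7(3) 9(5) by (auto simp: up)
      moreover have "r'' 13 = Suc 0" "r'' 21 = R + j" "r'' 20 = L + j" "r'' 19 = M - j"
        "\<forall>x<19. r'' x = r1 x"
        using 7(2) r' rr r 3 by auto
      moreover have "k \<le> 9 * t + 1" using 7(1) len by linarith
      ultimately show ?case using 3 by (simp add: less_Suc_eq all_conj_distrib)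
    qed (use T rr r in auto)
  next
    case (4 k2 r' h')
    have r': "\<forall>x<19. r' x = r1 x" using 4 by simp
    have rr: "\<forall>x<18. r' x = r x" using r' r1 by simp
    have len: "length (W u) \<le> t" using W u by simp
    have up: "\<forall>a\<ge>B. h' a = h1 a" using 4 R by simp
    show ?case
      apply (simp add: rr r)
    proof (rule Q, goal_cases)
      case 1
      then show ?case using 4(1) 9(1) len by (simp add: algebra_simps)
    next
      case 2
      then show ?case using rr by simp
    next
      case 3
      then show ?case using 4 h1 u by auto
    next
      case 4
      then show ?case using up 9(6) R u by simp
    next
      case 5
      then show ?case using \<open>\<forall>x<19. r' x = r1 x\<close> d 4 by auto
    qed
  qed
qed (use W u R h r in \<open>auto simp: vars_at_def\<close>)

definition conflicts :: com where
  "conflicts = Add 14 6 3 ;; Const 15 0 ;; Add 16 4 3 ;; Add 17 8 3 ;;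
     WhilePos 14
      (conflict_row ;; Add 15 15 13 ;; Add 16 16 13 ;; Add 17 17 7 ;; Sub 14 14 13)"

lemma row_major_eq:
  fixes N :: nat
  assumes "v < N" "v' < N"
  shows "u * N + v = u' * N + v' \<longleftrightarrow> u = u' \<and> v = v'"
proof
  assume *: "u * N + v = u' * N + v'"
  have "(u * N + v) div N = u" "(u' * N + v') div N = u'" using assms by simp_all
  with * show "u = u' \<and> v = v'" by simp
qed simp

lemma row_major_less:
  fixes N :: nat
  assumes "u < M" "v < N"
  shows "u * N + v < M * N"
proof -
  have "u * N + v < (u + 1) * N" using assms by simp
  also have "\<dots> \<le> M * N" using assms by (intro mult_le_mono1) simp
  finally show ?thesis .
qed

definition matrix :: "(nat \<Rightarrow> nat) \<Rightarrow> nat \<Rightarrow> nat \<Rightarrow> (nat \<Rightarrow> nat \<Rightarrow> bool) \<Rightarrow> bool" where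
  "matrix h B N A \<longleftrightarrow> (\<forall>u<N. \<forall>v<N. h (B + (u * N + v)) > 0 \<longleftrightarrow> A u v)"

text \<open>Rows have width M + 1, but only M entries of M rows are written. The row and column of
  the extra vertex are 0 because the memory from K on was.\<close>

lemma wp_conflicts:
  assumes r: "r 13 = 1" "r 3 = 0" "r 4 = L" "r 6 = M" "r 7 = N" "r 8 = K" "r 9 = K + N * N"
    and N: "N = Suc M" and K: "L + M \<le> K"
    and W: "\<forall>v<M. vars_at h (h (L + v)) (W v) \<and> h (L + v) + length (W v) < K \<and> length (W v) \<le> t"
    and h: "\<forall>a\<ge>K. h a = 0"
    and Q: "\<And>k r' h'. k \<le> M * (11 * t + M * (9 * t + 9) + 17) + 5 \<Longrightarrow> \<forall>x<14. r' x = r x \<Longrightarrow>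
      \<forall>a<K. h' a = h a \<Longrightarrow>
      matrix h' K N (\<lambda>u v. u < M \<and> v < M \<and>
        (if u = v then h (L + u) = 0 \<or> \<not> distinct (W u) else set (W u) \<inter> set (W v) \<noteq> {})) \<Longrightarrow>
      Q k r' h'"
  shows "wp conflicts Q r h"
proof -
  define C where "C = (\<lambda>u v. if u = v then h (L + u) = 0 \<or> \<not> distinct (W u) else set (W u) \<inter> set (W v) \<noteq> {})"
  let ?B = "K + N * N"
  show ?thesis
    unfolding conflicts_def
    apply (simp add: r)
  proof (rule wp_for[where n = M and b = "11 * t + M * (9 * t + 9) + 16" and I = "\<lambda>j r' h'.
      r' 15 = j \<and> r' 16 = L + j \<and> r' 17 = K + j * N \<and> (\<forall>x<14. r' x = r x) \<and>
      (\<forall>a<K. h' a = h a) \<and> (\<forall>a\<ge>?B. h' a \<le> j) \<and>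
      matrix h' K N (\<lambda>u v. u < j \<and> v < M \<and> C u v)"], goal_cases)
    case 1
    then show ?case by simp
  next
    case 2
    then show ?case using h by (simp add: matrix_def)
  next
    case (3 j r' h')
    have low: "\<forall>a<K. h' a = h a" using 3 by simp
    have j: "j < M" "r' 14 = M - j" by fact+
    have q: "h' (L + v) = h (L + v)" if "v < M" for v using low K that by simp
    have fit: "j * N + M < N * N" using row_major_less[of j N M N] j N by simp
    show ?case
      apply simp
    proof (rule wp_conflict_row[where L = L and M = M and B = ?B and u = j and R = "K + j * N"
          and W = W and t = t], goal_cases)
      case 12
      show ?case
      proof (intro allI impI conjI)
        fix v assume v: "v < M"
        then show "h' (L + v) + length (W v) < K + j * N" "length (W v) \<le> t"
          using W q by (auto intro: trans_less_add1)
        show "vars_at h' (h' (L + v)) (W v)" unfolding q[OF v]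
          by (rule vars_at_cong[where h = h and B = K]) (use W v low in auto)
      qed
    next
      case (14 k r'' h'')
      have R: "\<forall>x<18. r'' x = r' x" by (rule 14(2))
      have low': "\<forall>a<K. h'' a = h a" using 14(3) low N by simp
      have "matrix h'' K N (\<lambda>u v. u < Suc j \<and> v < M \<and> C u v)"
        unfolding matrix_def
      proof (intro allI impI)
        fix u v assume uv: "u < N" "v < N"
        show "h'' (K + (u * N + v)) > 0 \<longleftrightarrow> u < Suc j \<and> v < M \<and> C u v"
        proof (cases "u = j \<and> v < M")
          case True
          then show ?thesis using 14(5) q j by (auto simp: C_def add.assoc)
        next
          case False
          \<comment> \<open>Row-major coordinates are unique, so the cell of any other entry lies
            outside the M cells just written.\<close>
          have "\<not> (K + j * N \<le> K + (u * N + v) \<and> K + (u * N + v) < K + j * N + M)"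
          proof
            assume *: "K + j * N \<le> K + (u * N + v) \<and> K + (u * N + v) < K + j * N + M"
            then obtain w where w: "u * N + v = j * N + w" "w < M"
              by (metis add.assoc add_le_cancel_left add_less_cancel_left le_Suc_ex)
            then show False using row_major_eq[of v N w u j] uv N False by auto
          qed
          moreover have "K + (u * N + v) < ?B" using row_major_less[of u N v N] uv by simp
          ultimately have "h'' (K + (u * N + v)) = h' (K + (u * N + v))" using 14(3) by blast
          then show ?thesis using 3 uv False N unfolding matrix_def by auto
        qed
      qed
      then show ?case using R 3 14(1,4) low' r by (simp add: algebra_simps)
    qed (use 3 r K fit in auto)
  next
    case (4 k r' h')
    show ?case
      by (rule Q) (use 4 in \<open>simp_all only: C_def, simp_all add: algebra_simps\<close>)
  qed
qed

section \<open>Elimination on the machine\<close>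

text \<open>
  The matrix obtained by an elimination is written behind the one it is computed from; thus the
  initial conflict matrix survives for the next guess.
\<close>

definition set_if_both :: "nat \<Rightarrow> nat \<Rightarrow> com" where
  "set_if_both i j = IfPos i (IfPos j (Const 33 1) (Const 34 0)) (Const 34 0)"

lemma wp_set_if_both:
  assumes "\<And>k r'. k \<le> 3 \<Longrightarrow> \<forall>x<33. r' x = r x \<Longrightarrow>
    r' 33 = (if r i > 0 \<and> r j > 0 then 1 else r 33) \<Longrightarrow> Q k r' h"
  shows "wp (set_if_both i j) Q r h"
  unfolding set_if_both_def by (auto intro!: assms)

text \<open>For the current column vertex v, adding the cached loop of c (register 22) to the entry
  (v, c) makes register 31 positive exactly if v blocks c; register 32 does the same for d. Each
  entry thus takes constant time.\<close>

definition elim_row :: com where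
  "elim_row = WhilePos 30
     (Add 31 29 20 ;; Load 31 31 ;; Add 31 31 22 ;;
      Add 32 29 21 ;; Load 32 32 ;; Add 32 32 23 ;;
      Load 33 26 ;;
      set_if_both 27 32 ;; set_if_both 28 31 ;;
      Add 34 26 10 ;; Store 34 33 ;; Add 26 26 13 ;; Add 29 29 7 ;; Sub 30 30 13)"

definition elim_pass :: com where
  "elim_pass = Add 24 14 3 ;; Add 25 7 3 ;; Add 26 14 3 ;;
     WhilePos 25
      (Add 27 24 20 ;; Load 27 27 ;; Add 27 27 22 ;;
       Add 28 24 21 ;; Load 28 28 ;; Add 28 28 23 ;;
       Add 29 14 3 ;; Add 30 7 3 ;; elim_row ;; Add 24 24 7 ;; Sub 25 25 13)"

text \<open>The entries computed so far form an initial segment of the target matrix, which is why a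
  single flat index with \<open>div\<close> and \<open>mod\<close> is used.\<close>

lemma wp_elim_row:
  assumes r: "r 13 = 1" "r 7 = N" "r 10 = N * N" "r 14 = B" "r 20 = c" "r 21 = d" "r 30 = N"
      "r 29 = B" "r 26 = B + u * N"
    and c: "c < N" "d < N" "u < N"
    and m: "\<forall>i<N * N. h (B + i) > 0 \<longleftrightarrow> A (i div N) (i mod N)"
    and b: "r 22 > 0 \<longleftrightarrow> A c c" "r 23 > 0 \<longleftrightarrow> A d d"
      "r 27 > 0 \<longleftrightarrow> blocks A u c" "r 28 > 0 \<longleftrightarrow> blocks A u d"
    and old: "\<forall>i<u * N. h (B + N * N + i) > 0 \<longleftrightarrow> elim A c d (i div N) (i mod N)"
    and Q: "\<And>k r' h'. k \<le> 19 * N + 1 \<Longrightarrow> \<forall>x<26. r' x = r x \<Longrightarrow>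
      r' 26 = B + Suc u * N \<Longrightarrow>
      \<forall>a<B + N * N. h' a = h a \<Longrightarrow>
      \<forall>i<Suc u * N. h' (B + N * N + i) > 0 \<longleftrightarrow> elim A c d (i div N) (i mod N) \<Longrightarrow>
      Q k r' h'"
  shows "wp elim_row Q r h"
  unfolding elim_row_def
proof (rule wp_for[where n = N and b = 18 and I = "\<lambda>j r' h'.
      (\<forall>x<29. x \<noteq> 26 \<longrightarrow> r' x = r x) \<and> r' 26 = B + (u * N + j) \<and> r' 29 = B + j * N \<and>
      (\<forall>a<B + N * N. h' a = h a) \<and>
      (\<forall>i<u * N + j. h' (B + N * N + i) > 0 \<longleftrightarrow> elim A c d (i div N) (i mod N))"], goal_cases)
  case 2
  then show ?case using r old by simp
next
  case (3 j r' h')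
  have entry: "h (B + (v * N + w)) > 0 \<longleftrightarrow> A v w" if "v < N" "w < N" for v w
    using m row_major_less[of v N w N] that by simp
  have h': "h' (B + (v * N + w)) = h (B + (v * N + w))" if "v < N" "w < N" for v w
    using 3 row_major_less[of v N w N] that by simp
  have rr: "r' x = r x" if "x < 29" "x \<noteq> 26" for x using 3 that by blast
  have ij: "(u * N + j) div N = u" "(u * N + j) mod N = j" using 3 by simp_all
  have lt: "u * N + j < N * N" using row_major_less[of u N j N] c 3 by simp
  have 4: "r' 26 = B + (u * N + j)" "r' 29 = B + j * N" "r' 30 = N - j"
    "\<forall>a<B + N * N. h' a = h a"
    "\<forall>i<u * N + j. h' (B + N * N + i) > 0 \<longleftrightarrow> elim A c d (i div N) (i mod N)"
    using 3 by blast+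
  \<comment> \<open>This is register 33 after both conditional assignments; the later one is the
    outer case.\<close>
  define e where "e = (if r 28 > 0 \<and> (h (B + (j * N + c)) + r 22 > 0) then 1
      else if r 27 > 0 \<and> h (B + (j * N + d)) + r 23 > 0 then 1 else h (B + (u * N + j)))"
  have e: "e > 0 \<longleftrightarrow> elim A c d u j"
    unfolding e_def elim_def using b entry[of j c] entry[of j d] entry[of u j] c 3(1)
    by (auto simp: blocks_def)
  have fin: "\<forall>i<u * N + Suc j. (h'(B + N * N + (u * N + j) := e)) (B + N * N + i) > 0 \<longleftrightarrow>
      elim A c d (i div N) (i mod N)"
    using 4(5) e ij by (auto simp: less_Suc_eq)
  have fin2: "\<forall>a<B + N * N. (h'(B + N * N + (u * N + j) := e)) a = h a"
    using 4(4) by simp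
  have addr: "B + N * N + (u * N + j) = B + (u * N + j) + N * N" by simp
  have hc: "h' (B + (j * N + c)) = h (B + (j * N + c))" "h' (B + (j * N + d)) = h (B + (j * N + d))"
    "h' (B + (u * N + j)) = h (B + (u * N + j))"
    using h' c 3(1) by blast+
  note F = fin[unfolded addr] fin2[unfolded addr]
  show ?case
    apply (simp add: rr r hc 4(1-3) add.assoc)
  proof (rule wp_set_if_both, simp, rule wp_set_if_both, goal_cases)
    case (1 k1 r1 k2 r2)
    have "\<forall>x<31. r2 x = (r'(31 := h (B + (j * N + c)) + r 22, 32 := h (B + (j * N + d)) + r 23)) x"
      using 1(2,5) by simp
    note R = this[rule_format]
    have E: "r2 33 = e"
      using 1(3,6) 1(2)[rule_format] by (simp add: e_def rr R)
    show ?case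
      using F 1(1,4) 4(1-3) by (simp add: R E rr r add.assoc)
  qed
next
  case (4 k r' h')
  then show ?case by (intro Q) (auto simp: add.commute)
qed (rule r)

text \<open>The target is written in full, so the marks or the matrices of earlier guesses found
  there do no harm.\<close>

lemma wp_elim_pass:
  assumes r: "r 13 = 1" "r 3 = 0" "r 7 = N" "r 10 = N * N" "r 14 = B" "r 20 = c" "r 21 = d"
    and c: "c < N" "d < N"
    and A: "matrix h B N A"
    and b: "r 22 > 0 \<longleftrightarrow> A c c" "r 23 > 0 \<longleftrightarrow> A d d"
    and Q: "\<And>k r' h'. k \<le> N * (19 * N + 12) + 4 \<Longrightarrow> \<forall>x<24. r' x = r x \<Longrightarrow>
      \<forall>a<B + N * N. h' a = h a \<Longrightarrow> matrix h' (B + N * N) N (elim A c d) \<Longrightarrow> Q k r' h'"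
  shows "wp elim_pass Q r h"
proof -
  have flat: "\<forall>i<N * N. h (B + i) > 0 \<longleftrightarrow> A (i div N) (i mod N)"
  proof (intro allI impI)
    fix i assume i: "i < N * N"
    then have "i div N < N" "i mod N < N" using c by (simp_all add: less_mult_imp_div_less)
    then have "h (B + (i div N * N + i mod N)) > 0 \<longleftrightarrow> A (i div N) (i mod N)"
      using A unfolding matrix_def by blast
    then show "h (B + i) > 0 \<longleftrightarrow> A (i div N) (i mod N)" by simp
  qed
  show ?thesis
    unfolding elim_pass_def
    apply (simp add: r)
  proof (rule wp_for[where n = N and b = "19 * N + 11" and I = "\<lambda>j r' h'.
      (\<forall>x<24. r' x = r x) \<and> r' 24 = B + j * N \<and> r' 26 = B + j * N \<and>
      (\<forall>a<B + N * N. h' a = h a) \<and>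
      (\<forall>i<j * N. h' (B + N * N + i) > 0 \<longleftrightarrow> elim A c d (i div N) (i mod N))"], goal_cases)
    case 1
    then show ?case by simp
  next
    case 2
    then show ?case by simp
  next
    case (3 j r' h')
    have 4: "\<forall>x<24. r' x = r x" "r' 24 = B + j * N" "r' 26 = B + j * N" "r' 25 = N - j"
      "\<forall>a<B + N * N. h' a = h a"
      "\<forall>i<j * N. h' (B + N * N + i) > 0 \<longleftrightarrow> elim A c d (i div N) (i mod N)"
      using 3 by blast+
    have entry: "h' (B + (v * N + w)) > 0 \<longleftrightarrow> A v w" if "v < N" "w < N" for v w
      using flat 4(5) row_major_less[of v N w N] that by simp
    note rr = 4(1)[rule_format]
    show ?case
      apply (simp add: rr r 4(2-4))
    proof (rule wp_elim_row[where N = N and B = B and c = c and d = d and u = j and A = A], goal_cases)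
      case 13
      then show ?case using flat 4(5) by simp
    next
      case 16
      then show ?case using entry[OF 3(1) c(1)] b by (auto simp: blocks_def rr add.assoc)
    next
      case 17
      then show ?case using entry[OF 3(1) c(2)] b by (auto simp: blocks_def rr add.assoc)
    next
      case 18
      then show ?case using 4(6) by simp
    next
      case (19 k r'' h'')
      then show ?case using 4 r by (simp add: add.commute add.left_commute)
    qed (use 4 r c 3(1) b in auto)
  next
    case (4 k r' h')
    then have "matrix h' (B + N * N) N (elim A c d)"
      unfolding matrix_def using row_major_less[of _ N _ N] by simp
    then show ?case using 4 by (intro Q) (auto simp: algebra_simps)
  qed
qed

text \<open>Register 18 addresses the diagonal entry of candidate 3 * i, and N + 1 in register 11 is
  the distance to the next diagonal entry. Testing g and then the truncated g - 1 separates the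
  three digits.\<close>

definition pick :: com where
  "pick =
     Load 35 15 ;;
     IfPos 35 (Const 20 0 ;; Load 22 18) (Const 20 1 ;; Add 34 18 11 ;; Load 22 34) ;;
     Sub 35 35 13 ;; Add 34 18 11 ;;
     IfPos 35 (Const 21 1) (Const 21 2 ;; Add 34 34 11) ;; Load 23 34 ;;
     Add 20 20 17 ;; Add 21 21 17"

lemma wp_pick:
  assumes r: "r 13 = 1" "r 11 = Suc N" "r 17 = 3 * i" "r 18 = B + 3 * i * Suc N" "h (r 15) = g"
    and g: "g < 3"
    and i: "3 * i + 2 < N" and A: "matrix h B N A"
    and Q: "\<And>k r'. k \<le> 15 \<Longrightarrow> \<forall>x<20. r' x = r x \<Longrightarrow>
      r' 20 = 3 * i + lower g \<Longrightarrow> r' 21 = 3 * i + upper g \<Longrightarrow>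
      r' 22 > 0 \<longleftrightarrow> A (3 * i + lower g) (3 * i + lower g) \<Longrightarrow>
      r' 23 > 0 \<longleftrightarrow> A (3 * i + upper g) (3 * i + upper g) \<Longrightarrow> Q k r' h"
  shows "wp pick Q r h"
proof -
  have diag: "h (B + 3 * i * Suc N + a * Suc N) > 0 \<longleftrightarrow> A (3 * i + a) (3 * i + a)" if "a \<le> 2" for a
  proof -
    have "h (B + ((3 * i + a) * N + (3 * i + a))) > 0 \<longleftrightarrow> A (3 * i + a) (3 * i + a)"
      using A i that by (simp add: matrix_def)
    then show ?thesis by (simp add: algebra_simps)
  qed
  have g3: "g = 0 \<or> g = 1 \<or> g = 2" using g by auto
  show ?thesis
    unfolding pick_def
    using g3
  proof (elim disjE, goal_cases)
    case 1
    show ?case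
      using diag[of 1] diag[of 2] 1
      by (auto simp: r lower_def upper_def add_ac intro!: Q)
  next
    case 2
    show ?case
      using diag[of 0] diag[of 2] 2
      by (auto simp: r lower_def upper_def add_ac intro!: Q)
  next
    case 3
    show ?case
      using diag[of 0] diag[of 1] 3
      by (auto simp: r lower_def upper_def add_ac intro!: Q)
  qed
qed

section \<open>Enumeration of the guesses\<close>

text \<open>Register 16 is the parity of the clause number: the digit address moves only after the
  second clause of a pair, which replaces a division by 2.\<close>

definition advance :: com where
  "advance =
     Add 14 14 10 ;; Add 18 18 10 ;; Add 18 18 11 ;; Add 18 18 11 ;; Add 18 18 11 ;;
     Add 17 17 13 ;; Add 17 17 13 ;; Add 17 17 13 ;;
     IfPos 16 (Add 15 15 13 ;; Const 16 0) (Const 16 1)"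

lemma wp_advance:
  assumes r: "r 13 = 1" "r 10 = N * N" "r 11 = Suc N" "r 14 = K + j * (N * N)" "r 15 = G + j div 2"
      "r 16 = j mod 2" "r 17 = 3 * j" "r 18 = K + j * (N * N) + 3 * j * Suc N"
    and Q: "\<And>k r'. k \<le> 11 \<Longrightarrow> r' 14 = K + Suc j * (N * N) \<Longrightarrow> r' 15 = G + Suc j div 2 \<Longrightarrow>
      r' 16 = Suc j mod 2 \<Longrightarrow> r' 17 = 3 * Suc j \<Longrightarrow>
      r' 18 = K + Suc j * (N * N) + 3 * Suc j * Suc N \<Longrightarrow>
      \<forall>x. x \<notin> {14, 15, 16, 17, 18} \<longrightarrow> r' x = r x \<Longrightarrow> Q k r' h"
  shows "wp advance Q r h"
proof -
  have "j mod 2 = 0 \<or> j mod 2 = 1" by auto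
  then show ?thesis
  proof
    assume "j mod 2 = 0"
    moreover from this have "Suc j div 2 = j div 2" "Suc j mod 2 = 1" by presburger+
    ultimately show ?thesis
      unfolding advance_def by (simp add: r) (rule Q; simp add: r algebra_simps)
  next
    assume "j mod 2 = 1"
    moreover from this have "Suc j div 2 = Suc (j div 2)" "Suc j mod 2 = 0" by presburger+
    ultimately show ?thesis
      unfolding advance_def by (simp add: r) (rule Q; simp add: r algebra_simps)
  qed
qed

definition test_guess :: com where
  "test_guess =
     Add 14 8 3 ;; Add 15 5 3 ;; Const 16 0 ;; Const 17 0 ;; Add 18 8 3 ;; Add 19 2 3 ;;
     WhilePos 19 (pick ;; elim_pass ;; advance ;; Sub 19 19 13) ;;
     Add 14 14 10 ;; Sub 14 14 13 ;; Load 14 14 ;; IfPos 14 (Const 14 0) (Const 0 1)"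

lemma wp_test_guess:
  assumes r: "r 13 = 1" "r 3 = 0" "r 2 = m" "r 5 = G" "r 7 = N" "r 8 = K" "r 10 = N * N" "r 11 = Suc N"
    and N: "N = Suc (3 * m)"
    and g: "\<forall>i<m. G + i div 2 < K \<and> h (G + i div 2) = g i \<and> g i < 3"
    and A: "matrix h K N A"
    and Q: "\<And>k r' h'. k \<le> m * (N * (19 * N + 12) + 32) + 12 \<Longrightarrow>
      \<forall>x<14. x \<noteq> 0 \<longrightarrow> r' x = r x \<Longrightarrow>
      r' 0 = (if elims g A m (3 * m) (3 * m) then r 0 else 1) \<Longrightarrow>
      \<forall>a<K + N * N. h' a = h a \<Longrightarrow> Q k r' h'"
  shows "wp test_guess Q r h"
  unfolding test_guess_def
  apply (simp add: r)
proof (rule wp_for[where n = m and b = "N * (19 * N + 12) + 31" and I = "\<lambda>j r' h'.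
      r' 14 = K + j * (N * N) \<and> r' 15 = G + j div 2 \<and> r' 16 = j mod 2 \<and> r' 17 = 3 * j \<and>
      r' 18 = K + j * (N * N) + 3 * j * Suc N \<and>
      (\<forall>x<14. r' x = r x) \<and> (\<forall>a<K + N * N. h' a = h a) \<and>
      matrix h' (K + j * (N * N)) N (elims g A j)"], goal_cases)
  case 1
  then show ?case by simp
next
  case 2
  then show ?case using A r by simp
next
  case (3 j r' h')
  have I: "r' 14 = K + j * (N * N)" "r' 15 = G + j div 2" "r' 16 = j mod 2" "r' 17 = 3 * j"
    "r' 18 = K + j * (N * N) + 3 * j * Suc N" "r' 19 = m - j"
    "\<forall>x<14. r' x = r x" "\<forall>a<K + N * N. h' a = h a" "matrix h' (K + j * (N * N)) N (elims g A j)"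
    using 3 by blast+
  note rr = I(7)[rule_format]
  have gj: "G + j div 2 < K" "h (G + j div 2) = g j" "g j < 3" using g 3 by blast+
  have gj': "h' (r' 15) = g j" using I(2,8) gj by simp
  have j: "3 * j + 2 < N" using 3 N by simp
  have lu: "lower (g j) \<le> 2" "upper (g j) \<le> 2" by (auto simp: lower_def upper_def)
  show ?case
    apply simp
  proof (rule wp_pick[where N = N and i = j and B = "K + j * (N * N)" and g = "g j" and A = "elims g A j"],
      goal_cases)
    case (9 k1 r1)
    show ?case
      unfolding wp_Seq
    proof (rule wp_elim_pass[where N = N and B = "K + j * (N * N)" and c = "3 * j + lower (g j)"
          and d = "3 * j + upper (g j)" and A = "elims g A j"], goal_cases)
      case (13 k2 r2 h2)
      have R: "\<forall>x<20. r2 x = r' x" using 9(2) 13(2) by simp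
      note R = this[rule_format]
      have H: "\<forall>a<K + N * N. h2 a = h a" using 13(3) I(8) by simp
      have M: "matrix h2 (K + Suc j * (N * N)) N (elims g A (Suc j))"
        using 13(4) by (simp add: add_ac)
      show ?case
      proof (rule wp_advance[where N = N and K = K and G = G and j = j], goal_cases)
        case (9 k3 r3)
        then show ?case
          using M H R 13(1) \<open>k1 \<le> 15\<close> by (simp add: rr r I)
      qed (simp_all add: R rr r I)
    qed (use 9 lu j I rr r in auto)
  qed (use I rr r gj gj' j in auto)
next
  case (4 k r' h')
  have I: "r' 14 = K + m * (N * N)" 
    "\<forall>x<14. r' x = r x" "\<forall>a<K + N * N. h' a = h a" "matrix h' (K + m * (N * N)) N (elims g A m)"
    using 4 by blast+
  \<comment> \<open>The last cell of the final matrix is the diagonal entry of the extra vertex 3 *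
    m.\<close>
  have "K + m * (N * N) + N * N - 1 = K + m * (N * N) + (3 * m * N + 3 * m)" by (simp add: N)
  moreover have "h' (K + m * (N * N) + (3 * m * N + 3 * m)) > 0 \<longleftrightarrow> elims g A m (3 * m) (3 * m)"
  proof -
    have "3 * m < N" by (simp add: N)
    then show ?thesis using I(4) unfolding matrix_def by blast
  qed
  ultimately have top: "h' (K + m * (N * N) + N * N - 1) > 0 \<longleftrightarrow> elims g A m (3 * m) (3 * m)" by simp
  note rr = I(2)[rule_format]
  show ?case
    using top 4(1) I(3) by (auto simp: rr r I(1) algebra_simps intro!: Q)
qed

text \<open>
  The guess is a number written in base 3, with an extra digit that becomes 1 after the last
  guess.
\<close>

definition next_guess :: com where
  "next_guess =
     Add 14 5 3 ;; Load 15 14 ;; Sub 15 15 13 ;;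
     WhilePos 15 (Store 14 3 ;; Add 14 14 13 ;; Load 15 14 ;; Sub 15 15 13) ;;
     Load 15 14 ;; Add 15 15 13 ;; Store 14 15 ;; Load 15 12 ;; Sub 36 13 15"

lemma digit_Suc: "digit d (Suc j) = digit (d div 3) j"
  by (simp add: digit_def div_mult2_eq)

lemma digit_increment:
  assumes "\<forall>i<c. digit d i = 2" "digit d c \<noteq> 2"
  shows "digit (Suc d) i = (if i < c then 0 else if i = c then Suc (digit d c) else digit d i)"
  using assms
proof (induction c arbitrary: d i)
  case 0
  then have "d mod 3 < 2" by (simp add: digit_def)
  then have "Suc d div 3 = d div 3" "Suc d mod 3 = Suc (d mod 3)" by presburger+
  then show ?case
    by (cases i) (simp_all add: digit_Suc, simp_all add: digit_def)
next
  case (Suc c)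
  then have "d mod 3 = 2" by (auto simp: digit_def dest: spec[of _ 0])
  then have *: "Suc d div 3 = Suc (d div 3)" "Suc d mod 3 = 0" by presburger+
  have "\<forall>i<c. digit (d div 3) i = 2" "digit (d div 3) c \<noteq> 2"
    using Suc.prems by (auto simp flip: digit_Suc)
  from Suc.IH[OF this] show ?case
    by (cases i) (simp_all add: digit_Suc *, simp add: digit_def *)
qed

lemma digit_eq_0: "d < 3 ^ j \<Longrightarrow> digit d j = 0"
  by (simp add: digit_def)

text \<open>A digit minus 1 is positive only for the digit 2, so the loop clears the c trailing
  digits 2 and then adds the carry. It stops by position P, where the digit is 0 as long as d < 3^P.
  Register 36, the signal to continue, is 1 minus the extra digit.\<close>

lemma wp_next_guess:
  assumes r: "r 13 = 1" "r 3 = 0" "r 5 = G" "r 12 = G + P"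
    and d: "d < 3 ^ P" "\<forall>i\<le>P. h (G + i) = digit d i"
    and Q: "\<And>k r' h'. k \<le> 5 * P + 9 \<Longrightarrow> \<forall>x<14. r' x = r x \<Longrightarrow>
      r' 36 = (if Suc d < 3 ^ P then 1 else 0) \<Longrightarrow>
      \<forall>i\<le>P. h' (G + i) = digit (Suc d) i \<Longrightarrow>
      \<forall>a. \<not> (G \<le> a \<and> a \<le> G + P) \<longrightarrow> h' a = h a \<Longrightarrow> Q k r' h'"
  shows "wp next_guess Q r h"
proof -
  define c where "c = (LEAST c. digit d c \<noteq> 2)"
  have P2: "digit d P \<noteq> 2" using digit_eq_0[OF d(1)] by simp
  have c: "c \<le> P" "digit d c \<noteq> 2" "\<forall>i<c. digit d i = 2"
    unfolding c_def using P2 LeastI[of "\<lambda>c. digit d c \<noteq> 2", OF P2]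
    by (auto intro: Least_le dest: not_less_Least)
  note inc = digit_increment[OF c(3,2)]
  have c_le: "digit d c \<le> 1" using c(2) digit_less[of d c] by linarith
  have last: "1 - digit (Suc d) P = (if Suc d < 3 ^ P then 1 else 0)"
  proof (cases "Suc d < 3 ^ P")
    case False
    with d(1) have "Suc d = 3 ^ P" by simp
    then show ?thesis by (simp add: digit_def)
  qed (simp add: digit_eq_0)
  show ?thesis
    unfolding next_guess_def
    apply (simp add: r)
  proof (rule wp_While[where n = c and b = 4 and I = "\<lambda>j r' h'.
      r' 14 = G + j \<and> r' 15 = h (G + j) - 1 \<and> (\<forall>x<14. r' x = r x) \<and>
      (\<forall>i<j. h' (G + i) = 0) \<and> (\<forall>a. \<not> (G \<le> a \<and> a < G + j) \<longrightarrow> h' a = h a)"], goal_cases)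
    case 1
    then show ?case by simp
  next
    case (2 j r' h')
    then show ?case using d c by simp
  next
    case (3 j r' h')
    then show ?case using r by (simp add: less_Suc_eq)
  next
    case (4 r' h')
    then show ?case using d c c_le by simp
  next
    case (5 k r' h')
    have I: "r' 14 = G + c" "\<forall>x<14. r' x = r x" "\<forall>i<c. h' (G + i) = 0"
      "\<forall>a. \<not> (G \<le> a \<and> a < G + c) \<longrightarrow> h' a = h a" using 5 by blast+
    note rr = I(2)[rule_format]
    have hc: "h' (G + c) = digit d c" using I(4) d c by simp
    have new: "\<forall>i\<le>P. (h'(G + c := Suc (digit d c))) (G + i) = digit (Suc d) i"
      using I(3,4) d(2) by (auto simp: inc)
    have "(h'(G + c := Suc (digit d c))) (G + P) = digit (Suc d) P" using new by blast
    moreover have "\<forall>a. \<not> (G \<le> a \<and> a \<le> G + P) \<longrightarrow> (h'(G + c := Suc (digit d c))) a = h a"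
      using I(4) c(1) by auto
    moreover have "k \<le> 5 * P + 1" using 5(1) c(1) by simp
    ultimately show ?case
      using I(2) new last by (auto simp: rr r hc I(1) intro!: Q)
  qed
qed

definition search :: com where
  "search = Const 36 1 ;; WhilePos 36 (test_guess ;; next_guess)"

text \<open>All 3^P guesses are tried even after a success, which fixes the number of iterations.
  Register 0 is never reset, so it accumulates the disjunction over the guesses.\<close>

lemma wp_search:
  assumes r: "r 0 = 0" "r 13 = 1" "r 3 = 0" "r 2 = m" "r 5 = G" "r 7 = N" "r 8 = K" "r 10 = N * N"
      "r 11 = Suc N" "r 12 = G + P"
    and N: "N = Suc (3 * m)" and P: "P = (m + 1) div 2" and K: "G + P < K"
    and A: "matrix h K N A"
    and h: "\<forall>i\<le>P. h (G + i) = 0"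
    and Q: "\<And>k r' h'. k \<le> 3 ^ P * (m * (N * (19 * N + 12) + 32) + 5 * P + 22) + 2 \<Longrightarrow>
      r' 0 = of_bool (\<exists>d<3 ^ P. \<not> elims (\<lambda>i. digit d (i div 2)) A m (3 * m) (3 * m)) \<Longrightarrow>
      Q k r' h'"
  shows "wp search Q r h"
proof -
  let ?ok = "\<lambda>d. \<not> elims (\<lambda>i. digit d (i div 2)) A m (3 * m) (3 * m)"
  show ?thesis
    unfolding search_def
    apply simp
  proof (rule wp_While[where n = "3 ^ P" and b = "m * (N * (19 * N + 12) + 32) + 5 * P + 21"
        and I = "\<lambda>d r' h'. r' 36 = (if d < 3 ^ P then 1 else 0) \<and>
          r' 0 = of_bool (\<exists>d'<d. ?ok d') \<and>
          (\<forall>x<14. x \<noteq> 0 \<longrightarrow> r' x = r x) \<and> (\<forall>i\<le>P. h' (G + i) = digit d i) \<and> matrix h' K N A"],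
      goal_cases)
    case 1
    then show ?case using r h A by (simp add: digit_def)
  next
    case (2 d r' h')
    then show ?case by simp
  next
    case (3 d r' h')
    have I: "r' 0 = of_bool (\<exists>d'<d. ?ok d')" "\<forall>x<14. x \<noteq> 0 \<longrightarrow> r' x = r x"
      "\<forall>i\<le>P. h' (G + i) = digit d i" "matrix h' K N A" using 3 by blast+
    have half: "i div 2 \<le> P" if "i < m" for i using that P by simp
    show ?case
      unfolding wp_Seq
    proof (rule wp_test_guess[where m = m and N = N and G = G and K = K and A = A
          and g = "\<lambda>i. digit d (i div 2)"], goal_cases)
      case 10
      show ?case
      proof (intro allI impI conjI)
        fix i assume "i < m"
        note * = half[OF this]
        show "G + i div 2 < K" using * K by simp
        show "h' (G + i div 2) = digit d (i div 2)" using * I(3) by blast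
        show "digit d (i div 2) < 3" by (rule digit_less)
      qed
    next
      case (12 k1 r1 h1)
      have R1: "\<forall>x<14. x \<noteq> 0 \<longrightarrow> r1 x = r x" using 12(2) I(2) by simp
      have H1: "\<forall>i\<le>P. h1 (G + i) = digit d i" using 12(4) I(3) K by simp
      have M1: "matrix h1 K N A"
        using I(4) 12(4) row_major_less[of _ N _ N] unfolding matrix_def by simp
      show ?case
      proof (rule wp_next_guess[where G = G and P = P and d = d], goal_cases)
        case (7 k2 r2 h2)
        have "h2 (K + a) = h1 (K + a)" for a using 7(5) K by simp
        then have "matrix h2 K N A" using M1 by (simp add: matrix_def)
        moreover have "r2 0 = of_bool (\<exists>d'<Suc d. ?ok d')"
          using 7(2) 12(3) I(1) by (auto simp: less_Suc_eq)
        ultimately show ?case using 7 12(1) R1 by simp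
      qed (use R1 r H1 3 in auto)
    qed (use I r N in auto)
  next
    case (4 r' h')
    then show ?case by simp
  next
    case (5 k r' h')
    then show ?case by (intro Q) (auto simp: add_ac)
  qed
qed

section \<open>The complete program\<close>

text \<open>\<open>Store 3 3\<close> clears cell 0, where the first run of \<open>scan\<close> may
  have left an address. A vacant table entry, being 0, then points to a length field 0.\<close>

definition read_input :: com where
  "read_input =
     Const 13 1 ;; Load 2 13 ;; scan ;; Add 4 16 3 ;; Store 3 3 ;;
     Add 14 4 3 ;; Const 15 1 ;; scan ;; Add 5 14 3"

text \<open>An empty term is usable and a vacant position is not, although \<open>cand_vars\<close>
  is empty for both; only the address 0 tells them apart.\<close>

definition candidates_at :: "psp \<Rightarrow> (nat \<Rightarrow> nat) \<Rightarrow> nat \<Rightarrow> bool" where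
  "candidates_at F h L \<longleftrightarrow> (\<forall>u<3 * length F.
     vars_at h (h (L + u)) (cand_vars F u) \<and> h (L + u) + length (cand_vars F u) < L \<and>
     (h (L + u) = 0 \<longleftrightarrow> cand F u = None))"

lemma located_vars_at:
  assumes "located xs q (encode_term T)" "\<forall>a. 0 < a \<and> a < length xs \<longrightarrow> h a = xs ! a"
  shows "vars_at h q T" "q + length T < length xs" "q > 0"
proof -
  from assms(1) obtain ps zs where xs: "xs = ps @ (length T # T) @ zs" "length ps = q" "0 < q"
    unfolding located_def encode_term_def by blast
  then show "q + length T < length xs" "q > 0" by auto
  then have "h (q + j) = (length T # T) ! j" if "j \<le> length T" for j
  proof -
    have "(length T # T @ zs) ! j = (length T # T) ! j"
      using that by (cases j) (simp_all add: nth_append)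
    then show ?thesis using assms(2) xs that by (simp add: nth_append)
  qed
  from this[of 0] this[of "Suc _"] show "vars_at h q T"
    by (simp add: vars_at_def)
qed

lemma wp_read_input:
  assumes F: "\<forall>C\<in>set F. length C \<le> 3"
    and xs: "xs = encode_psp n F" and L: "L = length xs" and m: "m = length F"
    and Q: "\<And>k r' h'. k \<le> 60 * m + 13 \<Longrightarrow> r' 13 = 1 \<Longrightarrow> r' 3 = 0 \<Longrightarrow> r' 0 = 0 \<Longrightarrow> r' 2 = m \<Longrightarrow>
      r' 4 = L \<Longrightarrow> r' 5 = L + 3 * m \<Longrightarrow> \<forall>a\<ge>L + 3 * m. h' a = 0 \<Longrightarrow>
      candidates_at F h' L \<Longrightarrow> Q k r' h'"
  shows "wp read_input Q (fst (init_state xs)) (snd (init_state xs))"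
proof -
  let ?h = "\<lambda>a. if a < length xs then xs ! a else 0"
  have L2: "2 \<le> L" and xs1: "xs ! Suc 0 = m" by (simp_all add: L m xs encode_psp_def)
  show ?thesis
    unfolding read_input_def init_state_def
    apply (simp add: L2[unfolded L numeral_2_eq_2 Suc_le_eq])
  proof (rule wp_scan[where F = F and xs = xs and n = n], goal_cases)
    case (8 k1 r1 h1)
    have R1: "r1 13 = 1" "r1 3 = 0" "r1 2 = m" "r1 0 = 0" "r1 16 = L"
      using 8(4) 8(2) L2 xs1 L by auto
    have H1: "\<forall>x. x \<noteq> 0 \<longrightarrow> h1 x = ?h x" using 8(5) by simp
    show ?case
      apply (simp add: R1)
    proof (rule wp_scan[where F = F and xs = xs and n = n], goal_cases)
      case 7
      then show ?case using H1 by simp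
    next
      case (8 k2 r2 h2)
      have R2: "r2 13 = 1" "r2 3 = 0" "r2 2 = m" "r2 0 = 0" "r2 4 = L" "r2 14 = L + 3 * m"
        using 8(4) 8(3) R1 m by auto
      have H2: "\<forall>x. (\<forall>i<m. \<forall>a<length (F ! i). x \<noteq> L + (3 * i + a)) \<longrightarrow> h2 x = (h1(0 := 0)) x"
        using 8(5) R1 m by simp
      have T2: "\<forall>i<m. \<forall>a<length (F ! i). located xs (h2 (L + (3 * i + a))) (encode_term (F ! i ! a))"
        using 8(6) R1 m by simp
      have F3: "length (F ! i) \<le> 3" if "i < m" for i using F that m by simp
      have zero: "h2 0 = 0" using H2 L2 by simp
      have inp: "\<forall>a. 0 < a \<and> a < length xs \<longrightarrow> h2 a = xs ! a"
        using H2 H1 L by simp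
      have cand: "candidates_at F h2 L"
        unfolding candidates_at_def
      proof (intro allI impI)
        fix u assume u: "u < 3 * length F"
        define i a where "i = u div 3" and "a = u mod 3"
        have ua: "u = 3 * i + a" "i < m" "a < 3" using u m by (auto simp: i_def a_def)
        show "vars_at h2 (h2 (L + u)) (cand_vars F u) \<and> h2 (L + u) + length (cand_vars F u) < L \<and>
          (h2 (L + u) = 0 \<longleftrightarrow> cand F u = None)"
        proof (cases "a < length (F ! i)")
          case True
          then have c: "cand F u = Some (F ! i ! a)" using ua(2) m by (simp add: cand_def i_def a_def)
          have "located xs (h2 (L + u)) (encode_term (F ! i ! a))" using T2 ua(1,2) True by blast
          from located_vars_at[OF this inp] show ?thesis by (simp add: c cand_vars_def L)
        next
          case False
          then have c: "cand F u = None" by (simp add: cand_def i_def a_def)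
          have "L + u \<noteq> L + (3 * i' + a')" if "i' < m" "a' < length (F ! i')" for i' a'
          proof
            assume *: "L + u = L + (3 * i' + a')"
            have "a' < 3" using F3[OF that(1)] that(2) by simp
            with * ua(1,3) have "i' = i \<and> a' = a" using row_major_eq[of a 3 a' i i'] by simp
            then show False using False that by simp
          qed
          then have "h2 (L + u) = (h1(0 := 0)) (L + u)" using H2 by blast
          also have "\<dots> = 0" using H1 L L2 by simp
          finally show ?thesis using c zero L2 by (simp add: cand_vars_def vars_at_def)
        qed
      qed
      have "h2 a = 0" if "a \<ge> L + 3 * m" for a
      proof -
        have "a \<noteq> L + (3 * i + b)" if "i < m" "b < length (F ! i)" for i b
          using F3[OF that(1)] that \<open>a \<ge> L + 3 * m\<close> by linarith
        then have "h2 a = (h1(0 := 0)) a" using H2 by blast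
        then show ?thesis using H1 L that by simp
      qed
      then show ?case
        using cand R2 8(1) \<open>k1 \<le> 30 * length F + 3\<close> m by (auto intro!: Q)
    qed (use R1 F xs L m in auto)
  qed (use F xs xs1 m L2 L in auto)
qed

text \<open>
  Register 5: the base-3 digits of the guess, behind the table of the M = 3 * m candidates;
  6: M; 7: the dimension N = M + 1 of the matrices; 8: the conflict matrix; 9: the marks, later
  the matrices obtained by elimination; 10: N * N; 11: N + 1; 12: the address of
  the extra digit.
\<close>

definition layout :: com where
  "layout =
     Sub 6 5 4 ;; Add 7 6 13 ;; Add 8 5 7 ;; Add 9 8 3 ;;
     Add 14 7 3 ;; WhilePos 14 (Add 9 9 7 ;; Sub 14 14 13) ;;
     Sub 10 9 8 ;; Add 11 7 13 ;;
     Add 12 5 3 ;; Add 14 2 3 ;; WhilePos 14 (Add 12 12 13 ;; Sub 14 14 13 ;; Sub 14 14 13)"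

text \<open>N * N is accumulated by N additions. Counting m down by two with truncated subtraction
  takes (m + 1) div 2 rounds, which rounds up for odd m.\<close>

lemma wp_layout:
  assumes r: "r 13 = 1" "r 3 = 0" "r 2 = m" "r 4 = L" "r 5 = L + M" and N: "N = Suc M"
    and Q: "\<And>k r'. k \<le> 3 * N + 4 * m + 15 \<Longrightarrow> r' 6 = M \<Longrightarrow> r' 7 = N \<Longrightarrow> r' 8 = L + M + N \<Longrightarrow>
      r' 9 = L + M + N + N * N \<Longrightarrow> r' 10 = N * N \<Longrightarrow> r' 11 = Suc N \<Longrightarrow>
      r' 12 = L + M + (m + 1) div 2 \<Longrightarrow> \<forall>x\<in>{0, 2, 3, 4, 5, 13}. r' x = r x \<Longrightarrow> Q k r' h"
  shows "wp layout Q r h"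
  unfolding layout_def
  apply (simp add: r)
proof (rule wp_for[where n = N and b = 2 and I = "\<lambda>j r' h'. h' = h \<and>
    r' 9 = L + M + N + j * N \<and> r' 6 = M \<and> r' 7 = N \<and> r' 8 = L + M + N \<and>
    (\<forall>x\<in>{0, 2, 3, 4, 5, 13}. r' x = r x)"], goal_cases)
  case 1
  then show ?case by (simp add: N)
next
  case 2
  then show ?case by (simp add: N)
next
  case (3 j r' h')
  then show ?case using r by (simp add: add_ac)
next
  case (4 k1 r1 h1)
  let ?P = "(m + 1) div 2"
  have h1: "h1 = h" and R: "r1 9 = L + M + N + N * N" "r1 6 = M" "r1 7 = N" "r1 8 = L + M + N"
    "r1 0 = r 0" "r1 2 = m" "r1 3 = 0" "r1 4 = L" "r1 5 = L + M" "r1 13 = 1"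
    using 4 r by auto
  show ?case
    apply (simp add: R h1)
  proof (rule wp_While[where n = ?P and b = 3 and I = "\<lambda>j r' h'. h' = h \<and>
    r' 12 = L + M + j \<and> r' 14 = m - 2 * j \<and> r' 9 = L + M + N + N * N \<and> r' 6 = M \<and> r' 7 = N \<and>
    r' 8 = L + M + N \<and> r' 10 = N * N \<and> r' 11 = Suc N \<and>
    (\<forall>x\<in>{0, 2, 3, 4, 5, 13}. r' x = r x)"], goal_cases)
    case 1
    then show ?case using R r by simp
  next
    case (2 j r' h')
    then show ?case by auto
  next
    case (3 j r' h')
    then show ?case using r by simp
  next
    case (4 r' h')
    then show ?case by simp
  next
    case (5 k2 r2 h2)
    then have "h2 = h" by blast
    with 5 show ?case using \<open>k1 \<le> N * (2 + 1) + 1\<close> by (auto intro!: Q)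
  qed
qed

section \<open>The assembled program and its running time\<close>

definition tester :: com where
  "tester = read_input ;; layout ;; conflicts ;; search"

text \<open>These are the bounds of the four phases with M = 3 * m and N = 3 * m + 1 inserted; the
  summand 2 belongs to the search.\<close>

definition steps :: "nat \<Rightarrow> nat \<Rightarrow> nat" where
  "steps m t =
     60 * m + 13 + (3 * (3 * m + 1) + 4 * m + 15) +
     (3 * m * (11 * t + 3 * m * (9 * t + 9) + 17) + 5) + 2 +
     3 ^ ((m + 1) div 2) *
       (m * ((3 * m + 1) * (19 * (3 * m + 1) + 12) + 32) + 5 * ((m + 1) div 2) + 22)"

lemma tester_correct:
  assumes "is_PSP n m 3 t F"
  shows "\<exists>k. answers tester (encode_psp n F) k (has_multilinear_monomial F) \<and> k \<le> steps m t"
proof -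
  define xs L M N P where defs: "xs = encode_psp n F" "L = length xs" "M = 3 * m" "N = Suc M"
    "P = (m + 1) div 2"
  have m: "m = length F" and F: "\<forall>C\<in>set F. length C \<le> 3"
    and t: "\<forall>C\<in>set F. \<forall>T\<in>set C. length T \<le> t"
    using assms by (auto simp: is_PSP_def)
  have "P \<le> m" by (simp add: defs)
  have wt: "length (cand_vars F u) \<le> t" for u
    using t[rule_format, OF nth_mem nth_mem] by (simp add: cand_vars_def cand_def)
  have "wp tester (\<lambda>k r h. k \<le> steps m t \<and> r 0 = of_bool (has_multilinear_monomial F))
      (fst (init_state xs)) (snd (init_state xs))"
    unfolding tester_def wp_Seq
  proof (rule wp_read_input[OF F defs(1,2) m], goal_cases)
    case (1 k1 r1 h1)
    have H1: "h1 (L + u) + length (cand_vars F u) < L" "vars_at h1 (h1 (L + u)) (cand_vars F u)"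
      "h1 (L + u) = 0 \<longleftrightarrow> cand F u = None" if "u < M" for u
      using 1(9) that unfolding candidates_at_def defs(3) m by blast+
    show ?case
    proof (rule wp_layout[where m = m and L = L and M = M and N = N], goal_cases)
      case (7 k2 r2)
      have R2: "r2 0 = 0" "r2 2 = m" "r2 3 = 0" "r2 4 = L" "r2 5 = L + M" "r2 13 = 1"
        using 7(9) 1 by (auto simp: defs)
      show ?case
      proof (rule wp_conflicts[where L = L and M = M and N = N and K = "L + M + N"
            and W = "cand_vars F" and t = t], goal_cases)
        case 10
        then show ?case using H1 wt by (auto intro: trans_less_add1)
      next
        case (12 k3 r3 h3)
        note R3 = 12(2)[rule_format]
        have A: "matrix h3 (L + M + N) N (conflict F)"
        proof -
          have "conflict F u v \<longleftrightarrow> u < M \<and> v < M \<and> (if u = v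
              then h1 (L + u) = 0 \<or> \<not> distinct (cand_vars F u)
              else set (cand_vars F u) \<inter> set (cand_vars F v) \<noteq> {})" if "u < N" "v < N" for u v
          proof -
            have "cand F M = None" "cand_vars F M = []"
              by (simp_all add: cand_def cand_vars_def defs(3) m)
            moreover have "u \<noteq> M \<longleftrightarrow> u < M" "v \<noteq> M \<longleftrightarrow> v < M" using that defs(4) by auto
            ultimately show ?thesis
              using H1(3)[of u] by (auto simp: conflict_def unusable_def m defs(3))
          qed
          then show ?thesis using 12(4) by (simp add: matrix_def)
        qed
        show ?case
        proof (rule wp_search[where m = m and G = "L + M" and N = N and K = "L + M + N" and P = P
              and A = "conflict F"], goal_cases)
          case 15
          show ?case using 12(3) 1(8) \<open>P \<le> m\<close> by (simp add: defs(3,4))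
        next
          case (16 k4 r4 h4)
          have "k1 + (k2 + (k3 + k4)) \<le> steps m t"
            using 1(1) 7(1) 12(1) 16(1) unfolding steps_def defs(3-5) by simp
          then show ?case
            using 16(2) has_multilinear_monomial_elims[OF F m] by (simp add: defs(5) m)
        qed (use R2 R3 7 A \<open>P \<le> m\<close> in \<open>auto simp: defs(3-5)\<close>)
      qed (use R2 7 1(8) in \<open>auto simp: defs(3,4)\<close>)
    qed (use 1 in \<open>auto simp: defs\<close>)
  qed
  then show ?thesis
    unfolding wp_def answers_def defs(1) prod.collapse by blast
qed

text \<open>Since 3 * 1.02^2 = 3.1212 is below 1.7751^2 > 3.15, every clause leaves a spare factor
  1.02, and the powers of it pay for one factor m.\<close>

lemma steps_bound:
  assumes "m \<ge> 1" "t \<ge> 1"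
  shows "real (steps m t) \<le> 10 ^ 5 * (real t * real m ^ 2 * 1.7751 ^ m)"
proof -
  let ?P = "(m + 1) div 2"
  let ?e = "1.7751 ^ m :: real"
  have e1: "1 \<le> ?e" by (rule one_le_power) simp
  \<comment> \<open>For odd m the unpaired clause costs a full factor 3; the 3 on the right makes up
    for it.\<close>
  have P: "3 ^ ?P * 1.02 ^ m \<le> 3 * ?e"
  proof -
    have pair: "(3 * 1.02 ^ 2) ^ q \<le> (1.7751 ^ 2 :: real) ^ q" for q :: nat
      by (rule power_mono) (simp_all add: power2_eq_square)
    show ?thesis
    proof (cases "even m")
      case True
      then obtain q where "m = 2 * q" by blast
      then have "3 ^ ?P * 1.02 ^ m \<le> ?e"
        using pair[of q] by (simp add: power_mult power_mult_distrib)
      then show ?thesis using e1 by linarith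
    next
      case False
      then obtain q where q: "m = 2 * q + 1" by (rule oddE)
      have "(3 * 1.02 ^ 2) ^ q * (3 * 1.02) \<le> (1.7751 ^ 2) ^ q * (3 * 1.7751 :: real)"
        by (rule mult_mono[OF pair]) simp_all
      then show ?thesis using q by (simp add: power_mult power_mult_distrib power_add)
    qed
  qed
  \<comment> \<open>Bernoulli gives 1 + 0.02 * m \<le> 1.02^m, and 50 is 1 / 0.02.\<close>
  have m1: "real m \<le> 50 * 1.02 ^ m"
    using Bernoulli_inequality[of "0.02 :: real" m] by simp
  have pw: "real (3 ^ ?P) * real m \<le> 150 * ?e"
  proof -
    have "real (3 ^ ?P) * real m \<le> 3 ^ ?P * (50 * 1.02 ^ m)" using m1 by (simp add: mult_left_mono)
    also have "\<dots> = 50 * (3 ^ ?P * 1.02 ^ m)" by simp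
    also have "\<dots> \<le> 50 * (3 * ?e)" by (rule mult_left_mono[OF P]) simp
    finally show ?thesis by simp
  qed
  \<comment> \<open>With m and t at least 1, t * m^2 dominates every lower monomial of the
    preparation and m^3 every one of a guess. Hence 357 and 411 below are sums of
    coefficients.\<close>
  have low: "m \<le> t * m * m" "1 \<le> t * m * m" "m * m \<le> t * m * m" "t * m \<le> t * m * m"
    "m \<le> m * m * m" "1 \<le> m * m * m" "m * m \<le> m * m * m"
    using assms by auto
  have "60 * m + 13 + (3 * (3 * m + 1) + 4 * m + 15) +
      (3 * m * (11 * t + 3 * m * (9 * t + 9) + 17) + 5) + 2 =
      38 + 124 * m + 33 * (t * m) + 81 * (m * m) + 81 * (t * m * m)"
    by (simp add: algebra_simps)
  then have linear: "60 * m + 13 + (3 * (3 * m + 1) + 4 * m + 15) +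
      (3 * m * (11 * t + 3 * m * (9 * t + 9) + 17) + 5) + 2 \<le> 357 * (t * m * m)"
    using low by linarith
  have guess: "m * ((3 * m + 1) * (19 * (3 * m + 1) + 12) + 32) + 5 * ?P + 22 \<le> 411 * (m * m * m)"
  proof -
    have "m * ((3 * m + 1) * (19 * (3 * m + 1) + 12) + 32) =
        171 * (m * m * m) + 150 * (m * m) + 63 * m"
      by (simp add: algebra_simps)
    moreover have "?P \<le> m" using assms by simp
    ultimately show ?thesis using low by linarith
  qed
  have "steps m t \<le> 357 * (t * m * m) + 3 ^ ?P * (411 * (m * m * m))"
    unfolding steps_def by (rule add_mono[OF linear mult_le_mono2[OF guess]])
  then have "real (steps m t) \<le> real (357 * (t * m * m) + 3 ^ ?P * (411 * (m * m * m)))"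
    by (rule of_nat_mono)
  also have "\<dots> = 357 * (real t * real m ^ 2) + 411 * real m ^ 2 * (real (3 ^ ?P) * real m)"
    by (simp add: power2_eq_square)
  also have "\<dots> \<le> 357 * (real t * real m ^ 2 * ?e) + 411 * (real t * real m ^ 2) * (150 * ?e)"
  proof (rule add_mono)
    show "357 * (real t * real m ^ 2) \<le> 357 * (real t * real m ^ 2 * ?e)"
      using mult_left_mono[OF e1, of "real t * real m ^ 2"] by simp
    have "411 * real m ^ 2 \<le> 411 * (real t * real m ^ 2)" using assms by simp
    then show "411 * real m ^ 2 * (real (3 ^ ?P) * real m) \<le> 411 * (real t * real m ^ 2) * (150 * ?e)"
      by (rule mult_mono[OF _ pw]) simp_all
  qed
  \<comment> \<open>The exact constant is 357 + 411 * 150 = 62007.\<close>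
  also have "\<dots> \<le> 10 ^ 5 * (real t * real m ^ 2 * ?e)" by simp
  finally show ?thesis .
qed

theorem theorem8:
  "\<exists>(p :: com) (c :: real). \<forall>(n :: nat) (m :: nat) (t :: nat) (F :: psp).
     is_PSP n m 3 t F \<longrightarrow>
     (\<exists>k :: nat. answers p (encode_psp n F) k (has_multilinear_monomial F) \<and>
        (m \<ge> 1 \<and> t \<ge> 1 \<longrightarrow> real k \<le> c * (real t * real m ^ 2 * 1.7751 ^ m)))"
proof (rule exI[of _ tester], rule exI[of _ "10 ^ 5"], intro allI impI)
  fix n m t F assume "is_PSP n m 3 t F"
  then obtain k where "answers tester (encode_psp n F) k (has_multilinear_monomial F)" "k \<le> steps m t"
    using tester_correct by blast
  then show "\<exists>k. answers tester (encode_psp n F) k (has_multilinear_monomial F) \<and>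
      (m \<ge> 1 \<and> t \<ge> 1 \<longrightarrow> real k \<le> 10 ^ 5 * (real t * real m ^ 2 * 1.7751 ^ m))"
    using steps_bound[of m t] by (intro exI[of _ k]) (auto intro: order_trans[rotated])
qed

end
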